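(* Suppose $\{g_{S}: S\in\mathrm{Tab}_\tau\}$ satisfies property (SMP). Let $\rho:\mathcal P_\tau\to\mathcal P$ be the linear map $\rho\left(\sum_{S} f_S(x)\otimes S\right)=\sum_{S} f_S(x)g_S(x)$. Then, for the specialization of $(q,t)$ at which the $g_S$ are singular, $\rho$ intertwines $\mathbf w^q$, $\mathbf E_i$ and $\mathbf D_i^{q,t}$ with $\omega^q$, $\xi_i$ and $\mathcal D_i^{q,t}$ respectively; that is, $\mathbf w^q\rho=\rho\,\omega^q$, $\mathbf E_i\,\rho=\rho\,\xi_i$ and $\mathbf D_i^{q,t}\rho=\rho\,\mathcal D_i^{q,t}$ for $1\le i\le N$ (operators act on the right).
   Context: Tableaux. Let $N\ge 2$ and let $\tau$ be a partition of $N$. Its Ferrers diagram is the set of boxes $(i,j)$ (row $i$, column $j$), $1\le i\le \ell(\tau)$, $1\le j\le\tau_i$. $\mathrm{Tab}_\tau$ is the set of reverse standard Young tableaux of shape $\tau$: fillings of the boxes by $1,\dots,N$, each used once, decreasing along each row (as $j$ increases) and along each column (as $i$ increases). For $S\in\mathrm{Tab}_\tau$ the entry $k$ is in box $(\mathrm{row}_S[k],\mathrm{col}_S[k])$ and its content is $c_S[k]=\mathrm{col}_S[k]-\mathrm{row}_S[k]$. $S^{(i)}$ is the tableau obtained from $S$ by exchanging $i$ and $i+1$. Let $\mathbb F$ be an extension field of $\mathbb C$, $t\in\mathbb F$ transcendental over $\mathbb C$, $q\in\mathbb F$ nonzero (possibly related to $t$, e.g. $q=t^{-4}$), and $V_\tau$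 the $\mathbb F$-vector space with basis $\mathrm{Tab}_\tau$. All operators act on the right. The Hecke algebra $\mathcal H_N(t)$ is generated by $T_1,\dots,T_{N-1}$ with relations $(T_i+1)(T_i-t)=0$, $T_iT_{i+1}T_i=T_{i+1}T_iT_{i+1}$, and $T_iT_j=T_jT_i$ for $|i-j|>1$. The representation $\tau$ of $\mathcal H_N(t)$ on $V_\tau$ is given, with $b=c_S[i]-c_S[i+1]$, by: (I) if $\mathrm{row}_S[i]=\mathrm{row}_S[i+1]$, $S\tau(T_i)=tS$; (II) if $\mathrm{col}_S[i]=\mathrm{col}_S[i+1]$, $S\tau(T_i)=-S$; (III) if $\mathrm{row}_S[i]<\mathrm{row}_S[i+1]$ and $\mathrm{col}_S[i]>\mathrm{col}_S[i+1]$, $S\tau(T_i)=S^{(i)}+\frac{t-1}{1-t^{-b}}S$; (IV) if $b\le -2$, $S\tau(T_i)=\frac{t(t^{b+1}-1)(t^{b-1}-1)}{(t^b-1)^2}S^{(i)}+\frac{t^b(t-1)}{t^b-1}S$. $\mathcal P=\mathbb F[x_1,\dots,x_N]$; $p(xs_i)$ denotes $p$ with $x_i,x_{i+1}$ exchanged. Scalar operators on $\mathcal P$: $pT_i=(1-t)x_{i+1}\frac{p(x)-p(xs_i)}{x_i-x_{i+1}}+t\,p(xs_i)$; $f\omega^q=f(qx_N,x_1,\dots,x_{N-1})$; $\xi_i=t^{i-1}T_{i-1}^{-1}T_{i-2}^{-1}\cdots T_1^{-1}\omega^qT_{N-1}T_{N-2}\cdots T_i$; $f\mathcal D_N^{q,t}=(f-f\xi_N)/x_N$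 and $\mathcal D_i^{q,t}=\frac1tT_i\mathcal D_{i+1}^{q,t}T_i$ for $i<N$. Vector-valued operators on $\mathcal P_\tau=\mathcal P\otimes V_\tau$: $(f\otimes S)\mathbf T_i=(1-t)x_{i+1}\frac{f(x)-f(xs_i)}{x_i-x_{i+1}}\otimes S+f(xs_i)\otimes S\tau(T_i)$; $(f\otimes S)\mathbf w^q=t^{1-N}f\omega^q\otimes S\tau(T_1T_2\cdots T_{N-1})$; $\mathbf E_i=t^{i-1}\mathbf T_{i-1}^{-1}\cdots\mathbf T_1^{-1}\mathbf w^q\mathbf T_{N-1}\cdots\mathbf T_i$; $p\,\mathbf D_N^{q,t}=x_N^{-1}(p-p\mathbf E_N)$ and $\mathbf D_i^{q,t}=\frac1t\mathbf T_i\mathbf D_{i+1}^{q,t}\mathbf T_i$ for $i<N$. A basis $\{g_S\}$ of an $\mathcal H_N(t)$-invariant space of polynomials is a basis for a space of polynomials of isotype $\tau$ for $\mathcal H_N(t)$ if each $g_ST_i$ is given by (I)–(IV) with $S$, $S^{(i)}$ replaced by $g_S$, $g_{S^{(i)}}$. A polynomial $p$ is singular (at a specialization of $(q,t)$) if $p\mathcal D_i^{q,t}=0$ for all $1\le i\le N$ at that specialization. Property (SMP): $\{g_S:S\in\mathrm{Tab}_\tau\}$ is a basis for a space of polynomials of isotype $\tau$ for $\mathcal H_N(t)$ and every $g_S$ is singular, all with the same specialization of $(q,t)$. *)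

theory Defs
  imports
    Complex_Main
    "HOL-Library.Poly_Mapping"
    "HOL-Computational_Algebra.Polynomial"
    "HOL-Combinatorics.Transposition"
begin

section \<open>The coefficient field\<close>

definition field_embedding :: "(complex \<Rightarrow> 'f::field) \<Rightarrow> bool" where
  "field_embedding emb \<longleftrightarrow>
     emb 0 = 0 \<and> emb 1 = 1 \<and>
     (\<forall>x y. emb (x + y) = emb x + emb y) \<and> (\<forall>x y. emb (x * y) = emb x * emb y)"

definition transcendental_over :: "(complex \<Rightarrow> 'f::field) \<Rightarrow> 'f \<Rightarrow> bool" where
  "transcendental_over emb t \<longleftrightarrow> (\<forall>p::complex poly. p \<noteq> 0 \<longrightarrow> poly (map_poly emb p) t \<noteq> 0)"

section \<open>Partitions and reverse standard Young tableaux\<close>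

definition partition_of :: "nat \<Rightarrow> nat list \<Rightarrow> bool" where
  "partition_of N \<tau> \<longleftrightarrow> sorted_wrt (\<ge>) \<tau> \<and> 0 \<notin> set \<tau> \<and> sum_list \<tau> = N"

definition diagram :: "nat list \<Rightarrow> (nat \<times> nat) set" where
  "diagram \<tau> = {(i, j). 1 \<le> i \<and> i \<le> length \<tau> \<and> 1 \<le> j \<and> j \<le> \<tau> ! (i - 1)}"

text \<open>
  A filling is a function on all of \<open>nat \<times> nat\<close>; it is required to vanish off the diagram,
  so that a tableau is determined by its entries.
\<close>

type_synonym tableau = "nat \<times> nat \<Rightarrow> nat"

definition Tab :: "nat \<Rightarrow> nat list \<Rightarrow> tableau set" where
  "Tab N \<tau> = {S.
     bij_betw S (diagram \<tau>) {1..N} \<and>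
     (\<forall>b. b \<notin> diagram \<tau> \<longrightarrow> S b = 0) \<and>
     (\<forall>i j j'. (i, j) \<in> diagram \<tau> \<longrightarrow> (i, j') \<in> diagram \<tau> \<longrightarrow> j < j' \<longrightarrow> S (i, j) > S (i, j')) \<and>
     (\<forall>i i' j. (i, j) \<in> diagram \<tau> \<longrightarrow> (i', j) \<in> diagram \<tau> \<longrightarrow> i < i' \<longrightarrow> S (i, j) > S (i', j))}"

text \<open>Used only for \<open>k \<ge> 1\<close>, where the box is unique and lies in the diagram.\<close>

definition box :: "tableau \<Rightarrow> nat \<Rightarrow> nat \<times> nat" where
  "box S k = (THE b. S b = k)"

definition row :: "tableau \<Rightarrow> nat \<Rightarrow> nat" where
  "row S k = fst (box S k)"

definition col :: "tableau \<Rightarrow> nat \<Rightarrow> nat" where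
  "col S k = snd (box S k)"

definition content :: "tableau \<Rightarrow> nat \<Rightarrow> int" where
  "content S k = int (col S k) - int (row S k)"

definition swap_entries :: "nat \<Rightarrow> tableau \<Rightarrow> tableau" where
  "swap_entries i S = transpose i (i + 1) \<circ> S"

section \<open>Polynomials\<close>

text \<open>
  A polynomial is a finitely supported map from monomials to coefficients, a monomial being a
  finitely supported map from variable indices to exponents.  The type has variables
  \<open>x\<^sub>0, x\<^sub>1, \<dots>\<close>; \<open>Pol N\<close> is the subring in \<open>x\<^sub>1, \<dots>, x\<^sub>N\<close>.
\<close>

type_synonym 'f mpoly = "(nat \<Rightarrow>\<^sub>0 nat) \<Rightarrow>\<^sub>0 'f"

definition Pol :: "nat \<Rightarrow> ('f::field) mpoly set" where
  "Pol N = {p. \<forall>m \<in> Poly_Mapping.keys p. Poly_Mapping.keys m \<subseteq> {1..N}}"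

definition X :: "nat \<Rightarrow> ('f::field) mpoly" where
  "X i = Poly_Mapping.single (Poly_Mapping.single i 1) 1"

definition Const :: "'f::field \<Rightarrow> 'f mpoly" where
  "Const c = Poly_Mapping.single 0 c"

text \<open>
  Multiplication of all coefficients by \<open>c\<close>.  This serves for the field acting on polynomials and
  on \<open>V\<^sub>\<tau>\<close>, and for polynomials acting on \<open>P\<^sub>\<tau>\<close>.
\<close>

definition scale :: "'c::comm_ring_1 \<Rightarrow> ('k \<Rightarrow>\<^sub>0 'c) \<Rightarrow> ('k \<Rightarrow>\<^sub>0 'c)" where
  "scale c p = Poly_Mapping.map (\<lambda>a. c * a) p"

lemma lookup_scale: "Poly_Mapping.lookup (scale c p) k = c * Poly_Mapping.lookup p k"
  by (simp add: scale_def map.rep_eq when_def)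

text \<open>Hence the library constants \<open>module.span\<close> and \<open>module.dependent\<close> may be used with \<open>scale\<close>.\<close>

lemma vector_space_scale: "vector_space (scale :: 'f::field \<Rightarrow> ('k \<Rightarrow>\<^sub>0 'f) \<Rightarrow> ('k \<Rightarrow>\<^sub>0 'f))"
  by unfold_locales
    (auto intro!: poly_mapping_eqI simp: lookup_scale lookup_add algebra_simps)

text \<open>\<open>subst_vars \<sigma> p\<close> is \<open>p\<close> with every variable \<open>x\<^sub>v\<close> replaced by the polynomial \<open>\<sigma> v\<close>.\<close>

definition subst_vars :: "(nat \<Rightarrow> 'f mpoly) \<Rightarrow> ('f::field) mpoly \<Rightarrow> 'f mpoly" where
  "subst_vars \<sigma> p = (\<Sum>m\<in>Poly_Mapping.keys p.
     Const (Poly_Mapping.lookup p m) * (\<Prod>v\<in>Poly_Mapping.keys m. \<sigma> v ^ Poly_Mapping.lookup m v))"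

definition swap_vars :: "nat \<Rightarrow> ('f::field) mpoly \<Rightarrow> 'f mpoly" where
  "swap_vars i = subst_vars (\<lambda>v. X (transpose i (i + 1) v))"

text \<open>
  The exact quotient \<open>p / d\<close>; it is unique for \<open>d \<noteq> 0\<close> since polynomials form an integral domain.
  It exists in the uses below: \<open>p - p(xs\<^sub>i)\<close> vanishes at \<open>x\<^sub>i = x\<^sub>i\<^sub>+\<^sub>1\<close>, and \<open>p - p \<xi>\<^sub>N\<close> at \<open>x\<^sub>N = 0\<close>.
\<close>

definition exact_quot :: "('f::field) mpoly \<Rightarrow> 'f mpoly \<Rightarrow> 'f mpoly" where
  "exact_quot p d = (THE r. r * d = p)"

definition ddiff :: "nat \<Rightarrow> ('f::field) mpoly \<Rightarrow> 'f mpoly" where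
  "ddiff i p = exact_quot (p - swap_vars i p) (X i - X (i + 1))"

section \<open>Scalar operators\<close>

text \<open>
  Operators conventionally act on the right here; they are encoded as functions, so that
  \<open>p A\<^sub>1 A\<^sub>2 \<dots> A\<^sub>k\<close> is \<open>A\<^sub>k (\<dots> (A\<^sub>1 p))\<close>, and this is what \<open>fold A [1..<k+1] p\<close> computes.
\<close>

definition T :: "'f::field \<Rightarrow> nat \<Rightarrow> 'f mpoly \<Rightarrow> 'f mpoly" where
  "T t i p = scale (1 - t) (X (i + 1) * ddiff i p) + scale t (swap_vars i p)"

definition T_inv :: "nat \<Rightarrow> 'f::field \<Rightarrow> nat \<Rightarrow> 'f mpoly \<Rightarrow> 'f mpoly" where
  "T_inv N t i = inv_into (Pol N) (T t i)"

definition omega :: "nat \<Rightarrow> 'f::field \<Rightarrow> 'f mpoly \<Rightarrow> 'f mpoly" where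
  "omega N q = subst_vars (\<lambda>v. if v = 1 then scale q (X N) else X (v - 1))"

definition xi :: "nat \<Rightarrow> 'f::field \<Rightarrow> 'f \<Rightarrow> nat \<Rightarrow> 'f mpoly \<Rightarrow> 'f mpoly" where
  "xi N q t i p =
     scale (t ^ (i - 1))
       (fold (T t) (rev [i..<N]) (omega N q (fold (T_inv N t) (rev [1..<i]) p)))"

function D :: "nat \<Rightarrow> 'f::field \<Rightarrow> 'f \<Rightarrow> nat \<Rightarrow> 'f mpoly \<Rightarrow> 'f mpoly" where
  "D N q t i p =
     (if i < N then scale (1 / t) (T t i (D N q t (i + 1) (T t i p)))
      else exact_quot (p - xi N q t N p) (X N))"
  by pat_completeness auto
termination by (relation "measure (\<lambda>(N, q, t, i, p). N - i)") auto

declare D.simps [simp del]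

section \<open>The representation of the Hecke algebra on the span of the tableaux\<close>

text \<open>
  Rules (I)--(IV) for the action of \<open>T\<^sub>i\<close> on the vectors \<open>B S\<close> of a family indexed by tableaux, in
  a space with scalar multiplication \<open>scl\<close>.  The final \<open>0\<close> is never reached for
  \<open>S \<in> Tab N \<tau>\<close> and \<open>1 \<le> i < N\<close>.
\<close>

definition young_rule ::
  "('f::field \<Rightarrow> 'v \<Rightarrow> 'v) \<Rightarrow> 'f \<Rightarrow> nat \<Rightarrow> (tableau \<Rightarrow> 'v) \<Rightarrow> tableau \<Rightarrow> 'v::ab_group_add" where
  "young_rule scl t i B S =
     (let b = content S i - content S (i + 1) in
      if row S i = row S (i + 1) then scl t (B S)
      else if col S i = col S (i + 1) then - B S
      else if row S i < row S (i + 1) \<and> col S i > col S (i + 1) then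
        B (swap_entries i S) + scl ((t - 1) / (1 - t powi (- b))) (B S)
      else if b \<le> -2 then
        scl (t * (t powi (b + 1) - 1) * (t powi (b - 1) - 1) / (t powi b - 1)\<^sup>2)
          (B (swap_entries i S))
        + scl (t powi b * (t - 1) / (t powi b - 1)) (B S)
      else 0)"

text \<open>\<open>V\<^sub>\<tau>\<close> consists of the elements of this type that are supported on \<open>Tab N \<tau>\<close>.\<close>

type_synonym 'f tabvec = "tableau \<Rightarrow>\<^sub>0 'f"

definition tau_T :: "'f::field \<Rightarrow> nat \<Rightarrow> 'f tabvec \<Rightarrow> 'f tabvec" where
  "tau_T t i v =
     (\<Sum>S\<in>Poly_Mapping.keys v.
        scale (Poly_Mapping.lookup v S) (young_rule scale t i (\<lambda>S'. Poly_Mapping.single S' 1) S))"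

section \<open>Vector-valued operators\<close>

text \<open>\<open>\<Sum>\<^sub>S f\<^sub>S \<otimes> S\<close> is represented by the finitely supported map \<open>S \<mapsto> f\<^sub>S\<close>.\<close>

type_synonym 'f vpoly = "tableau \<Rightarrow>\<^sub>0 'f mpoly"

definition VPol :: "nat \<Rightarrow> nat list \<Rightarrow> ('f::field) vpoly set" where
  "VPol N \<tau> = {p. Poly_Mapping.keys p \<subseteq> Tab N \<tau> \<and> (\<forall>S. Poly_Mapping.lookup p S \<in> Pol N)}"

definition tensor :: "('f::field) mpoly \<Rightarrow> 'f tabvec \<Rightarrow> 'f vpoly" where
  "tensor f v = Poly_Mapping.map (\<lambda>c. scale c f) v"

text \<open>The additive extension of a map that is given on the tensors \<open>f \<otimes> S\<close>.\<close>

definition extend ::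
  "(('f::field) mpoly \<Rightarrow> tableau \<Rightarrow> 'v) \<Rightarrow> 'f vpoly \<Rightarrow> 'v::comm_monoid_add" where
  "extend \<phi> p = (\<Sum>S\<in>Poly_Mapping.keys p. \<phi> (Poly_Mapping.lookup p S) S)"

definition bT :: "'f::field \<Rightarrow> nat \<Rightarrow> 'f vpoly \<Rightarrow> 'f vpoly" where
  "bT t i = extend (\<lambda>f S.
     tensor (scale (1 - t) (X (i + 1) * ddiff i f)) (Poly_Mapping.single S 1)
     + tensor (swap_vars i f) (tau_T t i (Poly_Mapping.single S 1)))"

definition bT_inv :: "nat \<Rightarrow> nat list \<Rightarrow> 'f::field \<Rightarrow> nat \<Rightarrow> 'f vpoly \<Rightarrow> 'f vpoly" where
  "bT_inv N \<tau> t i = inv_into (VPol N \<tau>) (bT t i)"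

definition bw :: "nat \<Rightarrow> 'f::field \<Rightarrow> 'f \<Rightarrow> 'f vpoly \<Rightarrow> 'f vpoly" where
  "bw N q t = extend (\<lambda>f S.
     tensor (scale (t powi (1 - int N)) (omega N q f))
       (fold (tau_T t) [1..<N] (Poly_Mapping.single S 1)))"

definition bE ::
  "nat \<Rightarrow> nat list \<Rightarrow> 'f::field \<Rightarrow> 'f \<Rightarrow> nat \<Rightarrow> 'f vpoly \<Rightarrow> 'f vpoly" where
  "bE N \<tau> q t i p =
     scale (Const (t ^ (i - 1)))
       (fold (bT t) (rev [i..<N]) (bw N q t (fold (bT_inv N \<tau> t) (rev [1..<i]) p)))"

function bD ::
  "nat \<Rightarrow> nat list \<Rightarrow> 'f::field \<Rightarrow> 'f \<Rightarrow> nat \<Rightarrow> 'f vpoly \<Rightarrow> 'f vpoly" where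
  "bD N \<tau> q t i p =
     (if i < N then scale (Const (1 / t)) (bT t i (bD N \<tau> q t (i + 1) (bT t i p)))
      else Poly_Mapping.map (\<lambda>f. exact_quot f (X N)) (p - bE N \<tau> q t N p))"
  by pat_completeness auto
termination by (relation "measure (\<lambda>(N, \<tau>, q, t, i, p). N - i)") auto

declare bD.simps [simp del]

section \<open>Singular polynomials of isotype \<open>\<tau>\<close>\<close>

definition singular :: "nat \<Rightarrow> 'f::field \<Rightarrow> 'f \<Rightarrow> 'f mpoly \<Rightarrow> bool" where
  "singular N q t p \<longleftrightarrow> (\<forall>i\<in>{1..N}. D N q t i p = 0)"

definition isotype_basis ::
  "nat \<Rightarrow> 'f::field \<Rightarrow> nat list \<Rightarrow> (tableau \<Rightarrow> 'f mpoly) \<Rightarrow> bool" where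
  "isotype_basis N t \<tau> g \<longleftrightarrow>
     g ` Tab N \<tau> \<subseteq> Pol N \<and>
     inj_on g (Tab N \<tau>) \<and> \<not> module.dependent scale (g ` Tab N \<tau>) \<and>
     (\<forall>i. 1 \<le> i \<and> i < N \<longrightarrow>
        T t i ` module.span scale (g ` Tab N \<tau>) \<subseteq> module.span scale (g ` Tab N \<tau>)) \<and>
     (\<forall>i S. 1 \<le> i \<and> i < N \<longrightarrow> S \<in> Tab N \<tau> \<longrightarrow> T t i (g S) = young_rule scale t i g S)"

definition SMP ::
  "nat \<Rightarrow> 'f::field \<Rightarrow> 'f \<Rightarrow> nat list \<Rightarrow> (tableau \<Rightarrow> 'f mpoly) \<Rightarrow> bool" where
  "SMP N q t \<tau> g \<longleftrightarrow> isotype_basis N t \<tau> g \<and> (\<forall>S\<in>Tab N \<tau>. singular N q t (g S))"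

definition rho :: "(tableau \<Rightarrow> ('f::field) mpoly) \<Rightarrow> 'f vpoly \<Rightarrow> 'f mpoly" where
  "rho g = extend (\<lambda>f S. f * g S)"

end

theory Submission
  imports Defs
begin

text \<open>
  The Leibniz rule \<open>(f g) T\<^sub>i = (1 - t) x\<^sub>i\<^sub>+\<^sub>1 (\<partial>\<^sub>i f) g + (f s\<^sub>i) (g T\<^sub>i)\<close> shows that \<open>\<rho>\<close> intertwines the
  vector-valued and the scalar \<open>T\<^sub>i\<close>.  Since \<open>\<omega>\<close> is multiplicative, \<open>\<rho>\<close> intertwines \<open>w\<close> and \<open>\<omega>\<close> as
  soon as \<open>g\<^sub>S \<omega> = t\<^sup>1\<^sup>-\<^sup>N g\<^sub>S T\<^sub>1 \<dots> T\<^sub>N\<^sub>-\<^sub>1\<close>.  Singularity with respect to \<open>D\<^sub>N\<close> says that every \<open>g\<^sub>S\<close>, hence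
  every element of their span, is fixed by \<open>\<xi>\<^sub>N\<close>; applied to \<open>g\<^sub>S T\<^sub>1 \<dots> T\<^sub>N\<^sub>-\<^sub>1\<close>, which lies in the span,
  this is the required identity.  The remaining operators are compositions of \<open>T\<^sub>i\<close>, \<open>T\<^sub>i\<^sup>-\<^sup>1\<close>, \<open>\<omega>\<close>
  and an exact division by \<open>x\<^sub>N\<close>.  That this division is possible has to be proved, for scalar and
  for vector-valued polynomials, because \<^const>\<open>exact_quot\<close> is otherwise an unspecified value.
\<close>

abbreviation lookup where "lookup \<equiv> Poly_Mapping.lookup"
abbreviation keys where "keys \<equiv> Poly_Mapping.keys"
abbreviation single where "single \<equiv> Poly_Mapping.single"

section \<open>Finitely supported maps\<close>

lemma poly_mapping_decomp: "(\<Sum>k\<in>keys p. single k (lookup p k)) = p"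
proof (rule poly_mapping_eqI)
  fix k
  have "lookup (\<Sum>k\<in>keys p. single k (lookup p k)) k
      = (\<Sum>j\<in>keys p. if j = k then lookup p k else 0)"
    by (auto simp: lookup_sum lookup_single when_def intro!: sum.cong)
  then show "lookup (\<Sum>k\<in>keys p. single k (lookup p k)) k = lookup p k"
    by (simp add: in_keys_iff)
qed

text \<open>The single case ranges only over the actual coefficients of \<open>p\<close>, so a
  condition on these, such as lying in \<open>Pol N\<close>, is available there.\<close>

lemma poly_mapping_additiveI:
  fixes p :: "'k \<Rightarrow>\<^sub>0 'c::comm_monoid_add"
  assumes zero: "P 0"
    and add: "\<And>p q. P p \<Longrightarrow> P q \<Longrightarrow> P (p + q)"
    and single: "\<And>k. k \<in> keys p \<Longrightarrow> P (single k (lookup p k))"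
  shows "P p"
proof -
  have "P (\<Sum>k\<in>B. single k (lookup p k))" if "finite B" "B \<subseteq> keys p" for B
    using that by (induction rule: finite_induct) (auto intro: zero single add)
  from this[of "keys p"] show ?thesis
    by (simp add: poly_mapping_decomp)
qed

lemma poly_mapping_add_induct [consumes 1, case_names zero single add]:
  fixes p :: "'k \<Rightarrow>\<^sub>0 'c::comm_monoid_add"
  assumes "keys p \<subseteq> A"
    and "P 0"
    and "\<And>k c. k \<in> A \<Longrightarrow> P (single k c)"
    and "\<And>p q. P p \<Longrightarrow> P q \<Longrightarrow> P (p + q)"
  shows "P p"
  by (rule poly_mapping_additiveI) (use assms in auto)

text \<open>Over a commutative ring rather than a field, since polynomials also act on
  \<open>vpoly\<close>.\<close>

interpretation scale: module "scale :: 'c::comm_ring_1 \<Rightarrow> ('k \<Rightarrow>\<^sub>0 'c) \<Rightarrow> 'k \<Rightarrow>\<^sub>0 'c"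
  by unfold_locales (auto intro!: poly_mapping_eqI simp: lookup_scale lookup_add algebra_simps)

lemma scale_single [simp]: "scale c (single k d) = single k (c * d)"
  by (rule poly_mapping_eqI) (simp add: lookup_scale lookup_single when_def)

lemma keys_add_subset: "keys p \<subseteq> A \<Longrightarrow> keys q \<subseteq> A \<Longrightarrow> keys (p + q) \<subseteq> A"
  using keys_add[of p q] by blast

lemma keys_scale: "keys (scale c p) \<subseteq> keys p"
  by (auto simp: in_keys_iff lookup_scale)

lemma keys_scale_subset: "keys p \<subseteq> A \<Longrightarrow> keys (scale c p) \<subseteq> A"
  using keys_scale[of c p] by blast

section \<open>Polynomials\<close>

lemma Const_zero [simp]: "Const 0 = 0"
  and Const_one [simp]: "Const 1 = 1"
  by (simp_all add: Const_def)

lemma Const_add: "Const (a + b) = Const a + Const b"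
  and Const_diff: "Const (a - b) = Const a - Const b"
  and Const_uminus: "Const (- a) = - Const a"
  and Const_mult: "Const (a * b) = Const a * Const b"
  by (simp_all add: Const_def single_add single_diff single_uminus mult_single)

lemma scale_eq_Const_mult: "scale c p = Const c * p"
  by (simp add: scale_def Const_def mult_map_scale_conv_mult)

lemma X_neq_zero: "X i \<noteq> 0"
  unfolding X_def by (metis lookup_single_eq lookup_zero zero_neq_one)

lemma X_inj: "X i = (X j :: 'f::field mpoly) \<longleftrightarrow> i = j"
proof
  assume "X i = (X j :: 'f mpoly)"
  then have "keys (X i :: 'f mpoly) = keys (X j :: 'f mpoly)"
    by simp
  then have "single i (1::nat) = single j 1"
    by (simp add: X_def)
  then have "keys (single i (1::nat)) = keys (single j (1::nat))"
    by simp
  then show "i = j"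
    by simp
qed simp

text \<open>For \<open>A = UNIV\<close> this is the whole type, so one induction principle serves
  both closure of \<open>Pol N\<close> and unrestricted identities.\<close>

definition Vars :: "nat set \<Rightarrow> ('f::field) mpoly set" where
  "Vars A = {p. \<forall>m\<in>keys p. keys m \<subseteq> A}"

lemma Pol_eq_Vars: "Pol N = Vars {1..N}"
  by (simp add: Pol_def Vars_def)

lemma Vars_UNIV [simp]: "p \<in> Vars UNIV"
  by (simp add: Vars_def)

lemma Vars_zero [simp]: "0 \<in> Vars A"
  by (simp add: Vars_def)

lemma Vars_Const [simp]: "Const c \<in> Vars A"
  by (simp add: Vars_def Const_def)

lemma Vars_one [simp]: "1 \<in> Vars A"
  using Vars_Const[of 1 A] by simp

lemma Vars_X: "i \<in> A \<Longrightarrow> X i \<in> Vars A"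
  by (simp add: Vars_def X_def)

lemma Vars_add: "p \<in> Vars A \<Longrightarrow> q \<in> Vars A \<Longrightarrow> p + q \<in> Vars A"
  using keys_add[of p q] by (fastforce simp: Vars_def)

lemma keys_uminus: "keys (- p) = keys (p :: 'k \<Rightarrow>\<^sub>0 'c::ab_group_add)"
  by (auto simp: in_keys_iff)

lemma Vars_uminus: "p \<in> Vars A \<Longrightarrow> - p \<in> Vars A"
  by (simp add: Vars_def keys_uminus)

lemma Vars_diff: "p \<in> Vars A \<Longrightarrow> q \<in> Vars A \<Longrightarrow> p - q \<in> Vars A"
  using Vars_add[of p A "- q"] by (simp add: Vars_uminus)

lemma Vars_mult: "p \<in> Vars A \<Longrightarrow> q \<in> Vars A \<Longrightarrow> p * q \<in> Vars A"
proof (unfold Vars_def, intro CollectI ballI)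
  fix m
  assume p: "p \<in> {p. \<forall>m\<in>keys p. keys m \<subseteq> A}" and q: "q \<in> {p. \<forall>m\<in>keys p. keys m \<subseteq> A}"
    and "m \<in> keys (p * q)"
  then obtain a b where "m = a + b" "a \<in> keys p" "b \<in> keys q"
    using keys_mult[of p q] by blast
  then show "keys m \<subseteq> A"
    using p q keys_add[of a b] by blast
qed

lemmas Vars_intros = Vars_zero Vars_Const Vars_X Vars_add Vars_uminus Vars_diff Vars_mult

lemmas Pol_zero = Vars_zero[where A = "{1..N}" for N, folded Pol_eq_Vars]
lemmas Pol_add = Vars_add[where A = "{1..N}" for N, folded Pol_eq_Vars]
lemmas Pol_mult = Vars_mult[where A = "{1..N}" for N, folded Pol_eq_Vars]

lemma single_eq_X_power: "single (single v k) (1 :: 'f::field) = X v ^ k"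
proof (induction k)
  case (Suc k)
  have "single (single v (Suc k)) (1 :: 'f) = X v * single (single v k) 1"
    by (simp add: X_def mult_single flip: single_add)
  then show ?case
    by (simp add: Suc)
qed simp

lemma Vars_induct [consumes 1, case_names Const X add mult]:
  fixes p :: "'f::field mpoly"
  assumes "p \<in> Vars A"
    and Const: "\<And>c. P (Const c)"
    and X: "\<And>v. v \<in> A \<Longrightarrow> P (X v)"
    and add: "\<And>p q. p \<in> Vars A \<Longrightarrow> q \<in> Vars A \<Longrightarrow> P p \<Longrightarrow> P q \<Longrightarrow> P (p + q)"
    and mult: "\<And>p q. p \<in> Vars A \<Longrightarrow> q \<in> Vars A \<Longrightarrow> P p \<Longrightarrow> P q \<Longrightarrow> P (p * q)"
  shows "P p"
proof -
  define Q where "Q p \<longleftrightarrow> p \<in> Vars A \<and> P p" for p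
  have Qpow: "Q (X v ^ k)" if "v \<in> A" for v k
    using that by (induction k) (auto simp: Q_def intro: Vars_intros mult X Const[of 1, simplified])
  have Qmon: "Q (single m 1)" if "keys m \<subseteq> A" for m
    using that
  proof (induction m rule: poly_mapping_add_induct)
    case zero
    show ?case
      using Const[of 1] Vars_Const[of 1 A] by (simp add: Q_def)
  next
    case (single v k)
    then show ?case
      by (simp add: single_eq_X_power Qpow)
  next
    case (add m n)
    have "single (m + n) (1::'f) = single m 1 * single n 1"
      by (simp add: mult_single)
    with add show ?case
      by (simp add: Q_def Vars_mult mult)
  qed
  have "keys p \<subseteq> {m. keys m \<subseteq> A}"
    using assms(1) by (auto simp: Vars_def)
  then have "Q p"
  proof (induction p rule: poly_mapping_add_induct)
    case zero
    show ?case
      using Const[of 0] by (simp add: Q_def)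
  next
    case (single m c)
    have "single m c = Const c * single m 1"
      by (simp add: Const_def mult_single)
    moreover have "Q (single m 1)"
      using single by (simp add: Qmon)
    ultimately show ?case
      by (simp add: Q_def Vars_mult mult Const)
  next
    case (add p q)
    then show ?case
      by (simp add: Q_def Vars_add assms(4))
  qed
  then show ?thesis
    by (simp add: Q_def)
qed

subsection \<open>Substitution\<close>

definition subst_monom :: "(nat \<Rightarrow> 'f mpoly) \<Rightarrow> (nat \<Rightarrow>\<^sub>0 nat) \<Rightarrow> ('f::field) mpoly" where
  "subst_monom \<sigma> m = (\<Prod>v\<in>keys m. \<sigma> v ^ lookup m v)"

lemma subst_monom_superset:
  "finite A \<Longrightarrow> keys m \<subseteq> A \<Longrightarrow> subst_monom \<sigma> m = (\<Prod>v\<in>A. \<sigma> v ^ lookup m v)"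
  unfolding subst_monom_def by (rule prod.mono_neutral_left) (auto simp: in_keys_iff)

lemma subst_monom_add: "subst_monom \<sigma> (m + n) = subst_monom \<sigma> m * subst_monom \<sigma> n"
proof -
  let ?A = "keys m \<union> keys n"
  have "keys (m + n) \<subseteq> ?A"
    by (rule keys_add)
  then show ?thesis
    by (simp add: subst_monom_superset[of ?A] lookup_add power_add prod.distrib)
qed

lemma subst_vars_superset:
  "finite A \<Longrightarrow> keys p \<subseteq> A \<Longrightarrow>
    subst_vars \<sigma> p = (\<Sum>m\<in>A. Const (lookup p m) * subst_monom \<sigma> m)"
  unfolding subst_vars_def subst_monom_def
  by (rule sum.mono_neutral_left) (auto simp: in_keys_iff)

lemma subst_vars_zero [simp]: "subst_vars \<sigma> 0 = 0"
  by (simp add: subst_vars_def)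

lemma subst_vars_single: "subst_vars \<sigma> (single m c) = Const c * subst_monom \<sigma> m"
  by (subst subst_vars_superset[of "{m}"]) auto

lemma subst_vars_add: "subst_vars \<sigma> (p + q) = subst_vars \<sigma> p + subst_vars \<sigma> q"
proof -
  let ?A = "keys p \<union> keys q"
  have "keys (p + q) \<subseteq> ?A"
    by (rule keys_add)
  then show ?thesis
    by (simp add: subst_vars_superset[of ?A] lookup_add Const_add sum.distrib distrib_right)
qed

lemma subst_vars_uminus: "subst_vars \<sigma> (- p) = - subst_vars \<sigma> p"
  using subst_vars_add[of \<sigma> p "- p"] by (simp add: eq_neg_iff_add_eq_0 add.commute)

lemma subst_vars_diff: "subst_vars \<sigma> (p - q) = subst_vars \<sigma> p - subst_vars \<sigma> q"
  using subst_vars_add[of \<sigma> p "- q"] by (simp add: subst_vars_uminus)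

lemma subst_vars_mult: "subst_vars \<sigma> (p * q) = subst_vars \<sigma> p * subst_vars \<sigma> q"
proof (induction p rule: poly_mapping_add_induct[of _ UNIV, OF subset_UNIV])
  case (2 m c)
  show ?case
    by (induction q rule: poly_mapping_add_induct[of _ UNIV, OF subset_UNIV])
      (simp_all add: mult_single subst_vars_single subst_monom_add Const_mult subst_vars_add
        distrib_left)
qed (simp_all add: subst_vars_add distrib_right)

lemma subst_vars_Const [simp]: "subst_vars \<sigma> (Const c) = Const c"
  using subst_vars_single[of \<sigma> 0 c] by (simp add: subst_monom_def flip: Const_def)

lemma subst_vars_X [simp]: "subst_vars \<sigma> (X i) = \<sigma> i"
  unfolding X_def by (simp add: subst_vars_single subst_monom_def)

lemmas subst_vars_simps = subst_vars_add subst_vars_diff subst_vars_uminus subst_vars_mult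

lemma subst_vars_Vars:
  assumes "p \<in> Vars A" and "\<And>v. v \<in> A \<Longrightarrow> \<sigma> v \<in> Vars B"
  shows "subst_vars \<sigma> p \<in> Vars B"
  using assms(1)
  by (induction p rule: Vars_induct) (auto simp: subst_vars_simps intro: Vars_intros assms(2))

lemma subst_vars_comp:
  "subst_vars \<sigma> (subst_vars \<theta> p) = subst_vars (\<lambda>v. subst_vars \<sigma> (\<theta> v)) p"
  by (induction p rule: Vars_induct[OF Vars_UNIV]) (simp_all add: subst_vars_simps)

lemma subst_vars_ident: "subst_vars X p = p"
  by (induction p rule: Vars_induct[OF Vars_UNIV]) (simp_all add: subst_vars_simps)

text \<open>Modulo \<open>d\<close> the two substitutions are ring homomorphisms that agree on the
  variables.\<close>

lemma dvd_subst_vars_diff: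
  assumes "p \<in> Vars A" and "\<And>v. v \<in> A \<Longrightarrow> d dvd \<sigma> v - \<theta> v"
  shows "d dvd subst_vars \<sigma> p - subst_vars \<theta> p"
  using assms(1)
proof (induction p rule: Vars_induct)
  case (add p q)
  have "subst_vars \<sigma> (p + q) - subst_vars \<theta> (p + q)
      = (subst_vars \<sigma> p - subst_vars \<theta> p) + (subst_vars \<sigma> q - subst_vars \<theta> q)"
    by (simp add: subst_vars_simps)
  with add show ?case
    by simp
next
  case (mult p q)
  have "subst_vars \<sigma> (p * q) - subst_vars \<theta> (p * q)
      = (subst_vars \<sigma> p - subst_vars \<theta> p) * subst_vars \<sigma> q
        + subst_vars \<theta> p * (subst_vars \<sigma> q - subst_vars \<theta> q)"
    by (simp add: subst_vars_simps algebra_simps)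
  with mult show ?case
    by simp
qed (simp_all add: assms(2))

subsection \<open>Divided differences\<close>

lemma exact_quot_mult: "d \<noteq> 0 \<Longrightarrow> exact_quot (r * d) d = r"
  unfolding exact_quot_def by (rule the_equality) auto

lemma swap_vars_add: "swap_vars i (p + q) = swap_vars i p + swap_vars i q"
  and swap_vars_diff: "swap_vars i (p - q) = swap_vars i p - swap_vars i q"
  and swap_vars_mult: "swap_vars i (p * q) = swap_vars i p * swap_vars i q"
  and swap_vars_Const [simp]: "swap_vars i (Const c) = Const c"
  and swap_vars_zero [simp]: "swap_vars i 0 = 0"
  and swap_vars_X: "swap_vars i (X v) = X (transpose i (i + 1) v)"
  by (simp_all add: swap_vars_def subst_vars_simps)

lemma swap_vars_swap_vars [simp]: "swap_vars i (swap_vars i p) = p"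
  by (simp add: swap_vars_def subst_vars_comp subst_vars_ident)

lemma swap_vars_Vars: "p \<in> Vars A \<Longrightarrow> {i, i + 1} \<subseteq> A \<Longrightarrow> swap_vars i p \<in> Vars A"
  unfolding swap_vars_def
  by (rule subst_vars_Vars, assumption) (auto simp: transpose_def intro!: Vars_X)

text \<open>The twisted Leibniz rule builds the quotient for a product from those of the factors, so
  it exists and stays within the variables \<open>A\<close>.\<close>

lemma diff_swap_vars_factor:
  assumes "p \<in> Vars A" and "{i, i + 1} \<subseteq> A"
  shows "\<exists>r\<in>Vars A. r * (X i - X (i + 1)) = p - swap_vars i p"
  using assms(1)
proof (induction p rule: Vars_induct)
  case (Const c)
  show ?case
    by (rule bexI[of _ 0]) simp_all
next
  case (X v)
  consider "v = i" | "v = i + 1" | "v \<noteq> i" "v \<noteq> i + 1"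
    by blast
  then show ?case
  proof cases
    case 1
    then show ?thesis
      by (intro bexI[of _ "Const 1"]) (simp_all add: swap_vars_X)
  next
    case 2
    then show ?thesis
      by (intro bexI[of _ "- 1"]) (simp_all add: swap_vars_X Vars_uminus)
  next
    case 3
    then show ?thesis
      by (intro bexI[of _ 0]) (simp_all add: swap_vars_X)
  qed
next
  case (add p q)
  then obtain r s where "r \<in> Vars A" "r * (X i - X (i + 1)) = p - swap_vars i p"
    "s \<in> Vars A" "s * (X i - X (i + 1)) = q - swap_vars i q"
    by blast
  then show ?case
    by (intro bexI[of _ "r + s"] Vars_intros) (simp_all add: swap_vars_add distrib_right)
next
  case (mult p q)
  then obtain r s where "r \<in> Vars A" and r: "r * (X i - X (i + 1)) = p - swap_vars i p"
    and "s \<in> Vars A" and s: "s * (X i - X (i + 1)) = q - swap_vars i q"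
    by blast
  have "(r * q + swap_vars i p * s) * (X i - X (i + 1))
      = (r * (X i - X (i + 1))) * q + swap_vars i p * (s * (X i - X (i + 1)))"
    by (simp add: algebra_simps)
  also have "\<dots> = p * q - swap_vars i (p * q)"
    unfolding r s by (simp add: swap_vars_mult algebra_simps)
  finally show ?case
    using \<open>r \<in> Vars A\<close> \<open>s \<in> Vars A\<close> mult.hyps assms(2)
    by (intro bexI[of _ "r * q + swap_vars i p * s"] Vars_intros swap_vars_Vars)
qed

lemma X_diff_neq_zero: "X i - X (i + 1) \<noteq> (0 :: 'f::field mpoly)"
  by (simp add: X_inj)

lemma ddiff_eqI: "r * (X i - X (i + 1)) = p - swap_vars i p \<Longrightarrow> ddiff i p = r"
  unfolding ddiff_def by (metis exact_quot_mult X_diff_neq_zero)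

lemma ddiff_mult_eq: "ddiff i p * (X i - X (i + 1)) = p - swap_vars i p"
  using diff_swap_vars_factor[OF Vars_UNIV subset_UNIV] ddiff_eqI by metis

lemma ddiff_Vars: "p \<in> Vars A \<Longrightarrow> {i, i + 1} \<subseteq> A \<Longrightarrow> ddiff i p \<in> Vars A"
  using diff_swap_vars_factor ddiff_eqI by metis

lemma ddiff_zero [simp]: "ddiff i 0 = 0"
  by (rule ddiff_eqI) simp

lemma ddiff_add: "ddiff i (p + q) = ddiff i p + ddiff i q"
  by (rule ddiff_eqI) (simp only: distrib_right ddiff_mult_eq swap_vars_add, simp)

lemma ddiff_mult: "ddiff i (p * q) = ddiff i p * q + swap_vars i p * ddiff i q"
proof (rule ddiff_eqI)
  have "(ddiff i p * q + swap_vars i p * ddiff i q) * (X i - X (i + 1))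
      = (ddiff i p * (X i - X (i + 1))) * q + swap_vars i p * (ddiff i q * (X i - X (i + 1)))"
    by (simp add: algebra_simps)
  also have "\<dots> = p * q - swap_vars i (p * q)"
    unfolding ddiff_mult_eq by (simp add: swap_vars_mult algebra_simps)
  finally show "(ddiff i p * q + swap_vars i p * ddiff i q) * (X i - X (i + 1))
      = p * q - swap_vars i (p * q)" .
qed

lemma ddiff_Const [simp]: "ddiff i (Const c) = 0"
  by (rule ddiff_eqI) simp

lemma ddiff_X_Suc: "ddiff i (X (i + 1)) = - 1"
  by (rule ddiff_eqI) (simp add: swap_vars_X)

lemma ddiff_swap_vars: "ddiff i (swap_vars i p) = - ddiff i p"
  by (rule ddiff_eqI) (simp only: minus_mult_left[symmetric] ddiff_mult_eq, simp)

lemma swap_vars_ddiff: "swap_vars i (ddiff i p) = ddiff i p"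
proof (rule ddiff_eqI[symmetric])
  have "swap_vars i (ddiff i p * (X i - X (i + 1))) = swap_vars i p - p"
    unfolding ddiff_mult_eq by (simp add: swap_vars_diff)
  then show "swap_vars i (ddiff i p) * (X i - X (i + 1)) = p - swap_vars i p"
    by (simp add: swap_vars_mult swap_vars_diff swap_vars_X algebra_simps)
qed

lemma ddiff_ddiff [simp]: "ddiff i (ddiff i p) = 0"
  by (rule ddiff_eqI) (simp add: swap_vars_ddiff)

section \<open>The scalar Demazure--Lusztig operators\<close>

text \<open>The summand shared by the scalar and vector-valued T_i; the other one is t s_i,
  respectively s_i tensored with \<open>tau_T\<close>.\<close>

definition ddx :: "'f::field \<Rightarrow> nat \<Rightarrow> 'f mpoly \<Rightarrow> 'f mpoly" where
  "ddx t i p = Const (1 - t) * (X (i + 1) * ddiff i p)"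

lemma scale_ddiff_eq_ddx: "scale (1 - t) (X (i + 1) * ddiff i p) = ddx t i p"
  by (simp add: ddx_def scale_eq_Const_mult)

lemma T_eq: "T t i p = ddx t i p + Const t * swap_vars i p"
  unfolding T_def scale_ddiff_eq_ddx by (simp add: scale_eq_Const_mult)

lemma ddx_zero [simp]: "ddx t i 0 = 0"
  by (simp add: ddx_def)

lemma ddx_add: "ddx t i (p + q) = ddx t i p + ddx t i q"
  by (simp add: ddx_def ddiff_add distrib_left)

lemma ddx_mult: "ddx t i (p * q) = ddx t i p * q + swap_vars i p * ddx t i q"
  by (simp add: ddx_def ddiff_mult algebra_simps)

lemma ddx_Const_mult: "ddx t i (Const c * p) = Const c * ddx t i p"
  using ddx_mult[of t i "Const c" p] by (simp add: ddx_def)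

lemma ddx_Vars: "p \<in> Vars A \<Longrightarrow> {i, i + 1} \<subseteq> A \<Longrightarrow> ddx t i p \<in> Vars A"
  unfolding ddx_def by (intro Vars_intros ddiff_Vars) auto

lemma ddx_ddx: "ddx t i (ddx t i p) = Const (t - 1) * ddx t i p"
proof -
  have "ddx t i (ddx t i p) = Const (1 - t) * (X (i + 1) * ddiff i (Const (1 - t) * (X (i + 1) * ddiff i p)))"
    by (simp only: ddx_def)
  \<comment> \<open>By Leibniz only the derivative -1 of x_{i+1} survives, since
    \<open>ddiff_ddiff\<close> kills the other term.\<close>
  also have "\<dots> = - (Const (1 - t) * ddx t i p)"
    by (simp only: ddiff_mult ddiff_X_Suc) (simp add: ddx_def)
  finally show ?thesis
    by (simp add: Const_diff algebra_simps)
qed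

text \<open>The first term carries x_i and the second -x_{i+1} before the same divided difference,
  so the denominator is cleared. With \<open>ddx_ddx\<close> this gives the quadratic relation for
  scalar and vector-valued operators alike.\<close>

lemma ddx_swap_vars:
  "swap_vars i (ddx t i p) + ddx t i (swap_vars i p) = Const (t - 1) * swap_vars i p - Const (t - 1) * p"
proof -
  have "swap_vars i (ddx t i p) + ddx t i (swap_vars i p)
      = Const (1 - t) * (ddiff i p * (X i - X (i + 1)))"
    by (simp add: ddx_def swap_vars_mult swap_vars_X swap_vars_ddiff ddiff_swap_vars algebra_simps)
  then show ?thesis
    unfolding ddiff_mult_eq by (simp add: Const_diff algebra_simps)
qed

lemma T_zero [simp]: "T t i 0 = 0"
  by (simp add: T_eq)

lemma T_add: "T t i (p + q) = T t i p + T t i q"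
  by (simp add: T_eq ddx_add swap_vars_add algebra_simps)

lemma T_mult: "T t i (p * q) = ddx t i p * q + swap_vars i p * T t i q"
  by (simp add: T_eq ddx_mult swap_vars_mult algebra_simps)

lemma T_Const_mult: "T t i (Const c * p) = Const c * T t i p"
  using T_mult[of t i "Const c" p] by (simp add: ddx_def)

lemma T_Vars: "p \<in> Vars A \<Longrightarrow> {i, i + 1} \<subseteq> A \<Longrightarrow> T t i p \<in> Vars A"
  unfolding T_eq by (intro Vars_intros ddx_Vars swap_vars_Vars) auto

lemma T_quadratic: "T t i (T t i p) = Const (t - 1) * T t i p + Const t * p"
proof -
  have "T t i (T t i p) = ddx t i (ddx t i p)
      + Const t * (swap_vars i (ddx t i p) + ddx t i (swap_vars i p)) + Const t * (Const t * p)"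
    by (simp add: T_eq ddx_add swap_vars_add ddx_Const_mult swap_vars_mult algebra_simps)
  also have "\<dots> = Const (t - 1) * T t i p + Const t * p"
    unfolding ddx_ddx ddx_swap_vars by (simp add: T_eq Const_diff algebra_simps)
  finally show ?thesis .
qed

text \<open>The quadratic relation gives the inverse \<open>(T\<^sub>i - (t - 1)) / t\<close>, which is linear on all of
  the ambient type, unlike \<^const>\<open>T_inv\<close>.\<close>

definition T_linv :: "'f::field \<Rightarrow> nat \<Rightarrow> 'f mpoly \<Rightarrow> 'f mpoly" where
  "T_linv t i p = Const (1 / t) * (T t i p - Const (t - 1) * p)"

lemma T_linv_zero [simp]: "T_linv t i 0 = 0"
  and T_linv_add: "T_linv t i (p + q) = T_linv t i p + T_linv t i q"
  and T_linv_Const_mult: "T_linv t i (Const c * p) = Const c * T_linv t i p"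
  by (simp_all add: T_linv_def T_add T_Const_mult right_diff_distrib distrib_left mult.left_commute)

lemma T_linv_Vars: "p \<in> Vars A \<Longrightarrow> {i, i + 1} \<subseteq> A \<Longrightarrow> T_linv t i p \<in> Vars A"
  unfolding T_linv_def by (intro Vars_intros T_Vars) auto

lemma T_linv_T:
  assumes "t \<noteq> 0"
  shows "T_linv t i (T t i p) = p"
proof -
  have "T_linv t i (T t i p) = Const (1 / t) * (Const t * p)"
    by (simp add: T_linv_def T_quadratic)
  also have "\<dots> = Const (1 / t * t) * p"
    by (simp only: Const_mult mult.assoc)
  finally show ?thesis
    using assms by simp
qed

lemma T_T_linv:
  assumes "t \<noteq> 0"
  shows "T t i (T_linv t i p) = p"
proof -
  \<comment> \<open>\<open>T_linv\<close> is a polynomial in T_i, so the two commute.\<close>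
  have "T t i (T_linv t i p) = T_linv t i (T t i p)"
    using T_add[of t i "T t i p - Const (t - 1) * p" "Const (t - 1) * p"]
    by (simp add: T_linv_def T_Const_mult)
  with assms show ?thesis
    by (simp add: T_linv_T)
qed

text \<open>The left inverse makes T_i injective, and \<open>T_linv t i p\<close> is a preimage
  inside \<open>Pol N\<close>, so \<open>inv_into\<close> can only return it.\<close>

lemma T_inv_eq_T_linv:
  assumes "t \<noteq> 0" "1 \<le> i" "i < N" "p \<in> Pol N"
  shows "T_inv N t i p = T_linv t i p"
  unfolding T_inv_def
proof (rule inv_into_f_eq)
  show "inj_on (T t i) (Pol N)"
    by (rule inj_on_inverseI[of _ "T_linv t i"]) (simp add: T_linv_T assms)
qed (use assms in \<open>auto simp: Pol_eq_Vars T_T_linv intro!: T_linv_Vars\<close>)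

section \<open>Invariance, inversion and intertwining along compositions of operators\<close>

lemma fold_closed:
  assumes "\<And>x p. x \<in> set xs \<Longrightarrow> p \<in> V \<Longrightarrow> f x p \<in> V" and "p \<in> V"
  shows "fold f xs p \<in> V"
  using assms by (induction xs arbitrary: p) auto

lemma fold_inverse:
  assumes "\<And>x p. x \<in> set xs \<Longrightarrow> p \<in> V \<Longrightarrow> f x p \<in> V"
    and "\<And>x p. x \<in> set xs \<Longrightarrow> p \<in> V \<Longrightarrow> h x (f x p) = p" and "p \<in> V"
  shows "fold h (rev xs) (fold f xs p) = p"
  using assms by (induction xs arbitrary: p) auto

lemma fold_intertwine:
  assumes "\<And>x p. x \<in> set xs \<Longrightarrow> p \<in> V \<Longrightarrow> f x p \<in> V"
    and "\<And>x p. x \<in> set xs \<Longrightarrow> p \<in> V \<Longrightarrow> r (f x p) = h x (r p)" and "p \<in> V"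
  shows "r (fold f xs p) = fold h xs (r p)"
  using assms by (induction xs arbitrary: p) auto

section \<open>Divisibility by the last variable\<close>

text \<open>Modulo \<open>x\<^sub>i\<^sub>+\<^sub>1\<close> the operator \<open>T\<^sub>i\<close> is \<open>t s\<^sub>i\<close>, and \<open>s\<^sub>i\<close> carries the ideal \<open>(x\<^sub>i)\<close> to
  \<open>(x\<^sub>i\<^sub>+\<^sub>1)\<close>.  Hence \<open>T\<^sub>1 \<dots> T\<^sub>k\<^sub>-\<^sub>1\<close> is \<open>t\<^sup>k\<^sup>-\<^sup>1 s\<^sub>1 \<dots> s\<^sub>k\<^sub>-\<^sub>1\<close> modulo \<open>x\<^sub>k\<close>.  Here \<open>cyc k\<close> is
  \<open>s\<^sub>1 \<dots> s\<^sub>k\<^sub>-\<^sub>1\<close>, and \<open>cyc N\<close> agrees with \<open>\<omega>\<close> modulo \<open>x\<^sub>N\<close>.\<close>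

definition cyc :: "nat \<Rightarrow> ('f::field) mpoly \<Rightarrow> 'f mpoly" where
  "cyc k = subst_vars (\<lambda>v. if v = 1 then X k else if v \<le> k then X (v - 1) else X v)"

lemma cyc_one [simp]: "cyc (Suc 0) p = p"
proof -
  have "(\<lambda>v. if v = 1 then X (Suc 0) else if v \<le> Suc 0 then X (v - 1) else X v)
      = (X :: nat \<Rightarrow> 'a mpoly)"
    by (rule ext) (auto simp: le_Suc_eq)
  then show ?thesis
    by (simp only: cyc_def subst_vars_ident)
qed

text \<open>On variables: x_1 goes to x_k and then to x_{k+1}, while x_{k+1} goes to x_k.\<close>

lemma swap_vars_cyc:
  assumes "1 \<le> k"
  shows "swap_vars k (cyc k p) = cyc (Suc k) p"
proof -
  have "subst_vars (\<lambda>v. X (transpose k (k + 1) v))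
          (if v = 1 then X k else if v \<le> k then X (v - 1) else X v)
      = (if v = 1 then X (Suc k) else if v \<le> Suc k then X (v - 1) else X v :: 'a mpoly)" for v
    using assms by (auto simp: transpose_def)
  then show ?thesis
    unfolding swap_vars_def cyc_def subst_vars_comp by simp
qed

lemma X_dvd_fold_T_diff_cyc:
  "X (Suc k) dvd fold (T t) [1..<Suc k] p - Const (t ^ k) * cyc (Suc k) p"
proof (induction k)
  case (Suc k)
  let ?F = "fold (T t) [1..<Suc k] p"
  obtain r where r: "?F - Const (t ^ k) * cyc (Suc k) p = X (Suc k) * r"
    using Suc by (elim dvdE)
  \<comment> \<open>The swap moves the error term from the ideal of x_{k+1} to that of x_{k+2}; the
    \<open>ddx\<close> summand of the next operator has x_{k+2} as an explicit factor.\<close>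
  have "swap_vars (Suc k) ?F - Const (t ^ k) * cyc (Suc (Suc k)) p
      = swap_vars (Suc k) (?F - Const (t ^ k) * cyc (Suc k) p)"
    by (simp add: swap_vars_diff swap_vars_mult swap_vars_cyc)
  also have "\<dots> = X (Suc (Suc k)) * swap_vars (Suc k) r"
    unfolding r by (simp add: swap_vars_mult swap_vars_X)
  finally have swap: "swap_vars (Suc k) ?F
      = X (Suc (Suc k)) * swap_vars (Suc k) r + Const (t ^ k) * cyc (Suc (Suc k)) p"
    by (simp add: diff_eq_eq)
  have "fold (T t) [1..<Suc (Suc k)] p = T t (Suc k) ?F"
    by simp
  also have "\<dots> - Const (t ^ Suc k) * cyc (Suc (Suc k)) p
      = X (Suc (Suc k)) * (Const (1 - t) * ddiff (Suc k) ?F + Const t * swap_vars (Suc k) r)"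
    unfolding T_eq ddx_def swap by (simp add: Const_mult algebra_simps)
  finally show ?case
    by simp
qed simp

text \<open>Among the variables of \<open>Pol N\<close> the two substitutions differ at most on x_1,
  as q x_N against x_N.\<close>

lemma X_dvd_omega_diff_cyc: "p \<in> Pol N \<Longrightarrow> X N dvd omega N q p - cyc N p"
  unfolding Pol_eq_Vars omega_def cyc_def
  by (rule dvd_subst_vars_diff, assumption) (auto simp: scale_eq_Const_mult)

lemma omega_add: "omega N q (f + h) = omega N q f + omega N q h"
  and omega_mult: "omega N q (f * h) = omega N q f * omega N q h"
  and omega_Const [simp]: "omega N q (Const c) = Const c"
  and omega_zero [simp]: "omega N q 0 = 0"
  by (simp_all add: omega_def subst_vars_simps)

lemma omega_Pol: "1 \<le> N \<Longrightarrow> p \<in> Pol N \<Longrightarrow> omega N q p \<in> Pol N"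
  unfolding Pol_eq_Vars omega_def
  by (rule subst_vars_Vars, assumption)
    (auto simp: scale_eq_Const_mult intro!: Vars_intros)

text \<open>For \<open>i = N\<close> no T_i follows \<omega>. The inverses may be replaced by linear
  ones because every intermediate value stays in \<open>Pol N\<close>.\<close>

lemma xi_last_eq:
  assumes "t \<noteq> 0" "p \<in> Pol N"
  shows "xi N q t N p = Const (t ^ (N - 1)) * omega N q (fold (T_linv t) (rev [1..<N]) p)"
proof -
  have "fold (T_inv N t) xs p = fold (T_linv t) xs p \<and> fold (T_linv t) xs p \<in> Pol N"
    if "set xs \<subseteq> {1..<N}" for xs
    using that assms(2)
  proof (induction xs arbitrary: p)
    case (Cons x xs)
    then have "T_linv t x p \<in> Pol N"
      by (auto simp: Pol_eq_Vars intro!: T_linv_Vars)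
    with Cons show ?case
      by (simp add: T_inv_eq_T_linv assms(1))
  qed simp
  from this[of "rev [1..<N]"] show ?thesis
    by (simp add: xi_def scale_eq_Const_mult)
qed

text \<open>With h = p T_{N-1}^{-1} ... T_1^{-1}, both p = h T_1 ... T_{N-1} and p \<xi>_N = t^(N-1)
  h \<omega> are congruent to t^(N-1) \<open>cyc N h\<close> modulo x_N.\<close>

lemma X_dvd_diff_xi:
  assumes "t \<noteq> 0" "1 \<le> N" "p \<in> Pol N"
  shows "X N dvd p - xi N q t N p"
proof -
  define h where "h = fold (T_linv t) (rev [1..<N]) p"
  have "h \<in> Pol N"
    unfolding h_def Pol_eq_Vars
    by (rule fold_closed) (use assms in \<open>auto simp: Pol_eq_Vars intro!: T_linv_Vars\<close>)
  have "fold (T t) (rev (rev [1..<N])) h = p"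
    unfolding h_def
    by (rule fold_inverse[of _ UNIV]) (simp_all add: T_T_linv assms(1))
  then have p: "fold (T t) [1..<N] h = p"
    by simp
  have xi: "xi N q t N p = Const (t ^ (N - 1)) * omega N q h"
    by (simp add: xi_last_eq assms h_def)
  have "X N dvd p - Const (t ^ (N - 1)) * cyc N h"
    using X_dvd_fold_T_diff_cyc[of "N - 1" t h] assms(2) p by simp
  moreover have "X N dvd Const (t ^ (N - 1)) * (omega N q h - cyc N h)"
    by (intro dvd_mult X_dvd_omega_diff_cyc \<open>h \<in> Pol N\<close>)
  ultimately have "X N dvd (p - Const (t ^ (N - 1)) * cyc N h)
      - Const (t ^ (N - 1)) * (omega N q h - cyc N h)"
    by (rule dvd_diff)
  then show ?thesis
    by (simp add: xi algebra_simps)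
qed

section \<open>Tableaux\<close>

text \<open>\<open>box\<close> searches all cells; those off the diagram hold 0, and entries on it
  are positive and distinct, so only \<open>b\<close> qualifies.\<close>

lemma box_eq:
  assumes "S \<in> Tab N \<tau>" "b \<in> diagram \<tau>"
  shows "box S (S b) = b"
proof -
  have bij: "bij_betw S (diagram \<tau>) {1..N}" and off: "\<And>b. b \<notin> diagram \<tau> \<Longrightarrow> S b = 0"
    using assms(1) by (auto simp: Tab_def)
  have "S b \<in> {1..N}"
    using bij assms(2) by (auto simp: bij_betw_def)
  then have "c = b" if "S c = S b" for c
    using that off[of c] bij assms(2) by (cases "c \<in> diagram \<tau>") (auto simp: bij_betw_def dest: inj_onD)
  then show ?thesis
    unfolding box_def by (intro the_equality) auto
qed

lemma transpose_less:
  assumes "y < x" "\<not> (x = Suc i \<and> y = i)"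
  shows "transpose i (Suc i) y < transpose i (Suc i) x"
  using assms by (auto simp: transpose_def)

text \<open>Exchanging adjacent values can reverse only the comparison of \<open>i\<close> with
  \<open>i + 1\<close>, and these entries share neither a row nor a column.\<close>

lemma swap_entries_Tab:
  assumes S: "S \<in> Tab N \<tau>" and i: "1 \<le> i" "i < N"
    and row: "row S i \<noteq> row S (i + 1)" and col: "col S i \<noteq> col S (i + 1)"
  shows "swap_entries i S \<in> Tab N \<tau>"
proof -
  have "bij_betw (transpose i (i + 1)) {1..N} {1..N}"
    by (rule bij_betw_byWitness[of _ "transpose i (i + 1)"]) (use i in \<open>auto simp: transpose_def\<close>)
  moreover have "bij_betw S (diagram \<tau>) {1..N}"
    using S by (simp add: Tab_def)
  ultimately have 1: "bij_betw (swap_entries i S) (diagram \<tau>) {1..N}"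
    unfolding swap_entries_def by (rule bij_betw_trans[rotated])
  have 2: "swap_entries i S b = 0" if "b \<notin> diagram \<tau>" for b
    using S that i by (cases b) (auto simp: Tab_def swap_entries_def)
  have 3: "swap_entries i S c < swap_entries i S b"
    if "b \<in> diagram \<tau>" "c \<in> diagram \<tau>" "S c < S b" "fst b = fst c \<or> snd b = snd c" for b c
  proof -
    have "\<not> (S b = Suc i \<and> S c = i)"
      using box_eq[OF S that(1)] box_eq[OF S that(2)] that(4) row col
      by (auto simp: row_def col_def)
    then show ?thesis
      unfolding swap_entries_def using transpose_less[OF that(3)] by simp
  qed
  show ?thesis
    using S 1 2 3 unfolding Tab_def by simp
qed

section \<open>The vector-valued operators\<close>

text \<open>Cancellation may shrink the support of \<open>p + q\<close>, so all sums are taken over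
  the union of the supports. Every operator given as a sum over keys gets its additivity from
  here.\<close>

lemma sum_keys_add:
  fixes \<phi> :: "'c::comm_monoid_add \<Rightarrow> 'k \<Rightarrow> 'v::comm_monoid_add"
  assumes "\<And>S. \<phi> 0 S = 0" and "\<And>a b S. \<phi> (a + b) S = \<phi> a S + \<phi> b S"
  shows "(\<Sum>S\<in>keys (p + q). \<phi> (lookup (p + q) S) S)
    = (\<Sum>S\<in>keys p. \<phi> (lookup p S) S) + (\<Sum>S\<in>keys q. \<phi> (lookup q S) S)"
proof -
  let ?A = "keys p \<union> keys q"
  have *: "(\<Sum>S\<in>keys r. \<phi> (lookup r S) S) = (\<Sum>S\<in>?A. \<phi> (lookup r S) S)" if "keys r \<subseteq> ?A" for r
    using that by (intro sum.mono_neutral_left) (auto simp: in_keys_iff assms(1))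
  show ?thesis
    unfolding *[OF keys_add] *[OF Un_upper1] *[OF Un_upper2]
    by (simp add: assms(2) lookup_add sum.distrib)
qed

lemma lookup_tensor: "lookup (tensor f v) S = Const (lookup v S) * f"
  by (simp add: tensor_def map.rep_eq when_def scale_eq_Const_mult)

lemma tensor_add_left: "tensor (f + h) v = tensor f v + tensor h v"
  and tensor_add_right: "tensor f (v + w) = tensor f v + tensor f w"
  and tensor_zero_left [simp]: "tensor 0 v = 0"
  and tensor_zero_right [simp]: "tensor f 0 = 0"
  and tensor_mult_left: "tensor (h * f) v = scale h (tensor f v)"
  and tensor_scale_right: "tensor f (scale c v) = scale (Const c) (tensor f v)"
  and tensor_single: "tensor f (single S c) = single S (Const c * f)"
  by (auto intro!: poly_mapping_eqI simp: lookup_tensor lookup_add lookup_scale algebra_simps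
      Const_add Const_mult lookup_single when_def)

lemma keys_tensor: "keys (tensor f v) \<subseteq> keys v"
  by (auto simp: in_keys_iff lookup_tensor)

lemma tau_T_zero [simp]: "tau_T t i 0 = 0"
  by (simp add: tau_T_def)

lemma tau_T_add: "tau_T t i (v + w) = tau_T t i v + tau_T t i w"
  unfolding tau_T_def by (rule sum_keys_add) (simp_all add: scale.scale_left_distrib)

lemma tau_T_single:
  "tau_T t i (single S c) = scale c (young_rule scale t i (\<lambda>S'. single S' 1) S)"
  unfolding tau_T_def by (cases "c = 0") simp_all

lemma tau_T_scale: "tau_T t i (scale c v) = scale c (tau_T t i v)"
  by (induction v rule: poly_mapping_add_induct[OF subset_UNIV])
    (simp_all add: tau_T_single tau_T_add scale.scale_right_distrib)

lemma bT_zero [simp]: "bT t i 0 = 0"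
  by (simp add: bT_def extend_def)

lemma bT_add: "bT t i (p + q) = bT t i p + bT t i q"
  unfolding bT_def extend_def scale_ddiff_eq_ddx
  by (rule sum_keys_add) (simp_all add: ddx_add swap_vars_add tensor_add_left)

lemma bT_single:
  "bT t i (single S f) = tensor (ddx t i f) (single S 1) + tensor (swap_vars i f) (tau_T t i (single S 1))"
  unfolding bT_def extend_def scale_ddiff_eq_ddx by (cases "f = 0") simp_all

text \<open>Arbitrary \<open>v\<close> is needed for iteration, since \<open>tau_T\<close> sends a
  tableau to a combination of tableaux.\<close>

lemma bT_tensor: "bT t i (tensor f v) = tensor (ddx t i f) v + tensor (swap_vars i f) (tau_T t i v)"
proof (induction v rule: poly_mapping_add_induct[OF subset_UNIV])
  case (2 S c)
  have "tau_T t i (single S c) = scale c (tau_T t i (single S 1))"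
    using tau_T_scale[of t i c "single S 1"] by simp
  then show ?case
    by (simp add: tensor_single bT_single ddx_Const_mult swap_vars_mult tensor_mult_left
        tensor_scale_right)
qed (simp_all add: tensor_add_right bT_add tau_T_add)

lemma bT_scale: "bT t i (scale (Const c) p) = scale (Const c) (bT t i p)"
  by (induction p rule: poly_mapping_add_induct[OF subset_UNIV])
    (simp_all add: bT_single bT_add ddx_Const_mult swap_vars_mult tensor_mult_left
      scale.scale_right_distrib)

lemma bw_zero [simp]: "bw N q t 0 = 0"
  by (simp add: bw_def extend_def)

lemma bw_add: "bw N q t (p + r) = bw N q t p + bw N q t r"
  unfolding bw_def extend_def
  by (rule sum_keys_add) (simp_all add: scale_eq_Const_mult omega_add distrib_left tensor_add_left)

lemma bw_single:
  "bw N q t (single S f)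
    = tensor (Const (t powi (1 - int N)) * omega N q f) (fold (tau_T t) [1..<N] (single S 1))"
  unfolding bw_def extend_def scale_eq_Const_mult by (cases "f = 0") simp_all

lemma VPol_zero [simp]: "0 \<in> VPol N \<tau>"
  by (simp add: VPol_def Pol_eq_Vars)

lemma VPol_add: "p \<in> VPol N \<tau> \<Longrightarrow> r \<in> VPol N \<tau> \<Longrightarrow> p + r \<in> VPol N \<tau>"
  using keys_add[of p r] by (fastforce simp: VPol_def Pol_eq_Vars lookup_add intro: Vars_add)

lemma VPol_scale: "p \<in> VPol N \<tau> \<Longrightarrow> f \<in> Pol N \<Longrightarrow> scale f p \<in> VPol N \<tau>"
  using keys_scale[of f p] by (auto simp: VPol_def Pol_eq_Vars lookup_scale intro: Vars_mult)

lemma VPol_diff: "p \<in> VPol N \<tau> \<Longrightarrow> r \<in> VPol N \<tau> \<Longrightarrow> p - r \<in> VPol N \<tau>"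
  using VPol_add[of p N \<tau> "scale (Const (- 1)) r"] VPol_scale[of r N \<tau> "Const (- 1)"]
  by (simp add: Const_uminus Pol_eq_Vars Vars_uminus)

lemma VPol_tensor: "f \<in> Pol N \<Longrightarrow> keys v \<subseteq> Tab N \<tau> \<Longrightarrow> tensor f v \<in> VPol N \<tau>"
  using keys_tensor[of f v] by (auto simp: VPol_def Pol_eq_Vars lookup_tensor intro: Vars_mult)

text \<open>\<open>Poly_Mapping.map\<close> keeps zero coefficients zero; on the others the division
  by \<open>d\<close> is exact.\<close>

lemma map_exact_quot_scale: "d \<noteq> 0 \<Longrightarrow> Poly_Mapping.map (\<lambda>f. exact_quot f d) (scale d p) = p"
  by (rule poly_mapping_eqI)
    (auto simp: map.rep_eq lookup_scale when_def mult.commute[of d] exact_quot_mult)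

text \<open>The \<open>ddx\<close> part has x_{i+1} as an explicit factor, and s_i carries x_i to
  x_{i+1}.\<close>

lemma bT_scale_X: "\<exists>r. bT t i (scale (X i) p) = scale (X (Suc i)) r"
proof (induction p rule: poly_mapping_add_induct[OF subset_UNIV])
  case 1
  show ?case
    by (rule exI[of _ 0]) simp
next
  case (2 S f)
  have "bT t i (scale (X i) (single S f))
      = scale (X (Suc i)) (tensor (Const (1 - t) * ddiff i (X i * f)) (single S 1)
          + tensor (swap_vars i f) (tau_T t i (single S 1)))"
    by (simp add: bT_single swap_vars_mult swap_vars_X ddx_def scale.scale_right_distrib
        mult.left_commute flip: tensor_mult_left)
  then show ?case
    by blast
next
  case (3 p p')
  then obtain r r' where "bT t i (scale (X i) p) = scale (X (Suc i)) r"
    "bT t i (scale (X i) p') = scale (X (Suc i)) r'"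
    by blast
  then show ?case
    by (intro exI[of _ "r + r'"]) (simp add: scale.scale_right_distrib bT_add)
qed

text \<open>Vector analogue of the congruence with \<open>cyc\<close>: the action of
  \<open>tau_T\<close> takes the place of the factors t, so no power of t appears.\<close>

lemma fold_bT_tensor_mod_X:
  "\<exists>r. fold (bT t) [1..<Suc k] (tensor f v)
    = tensor (cyc (Suc k) f) (fold (tau_T t) [1..<Suc k] v) + scale (X (Suc k)) r"
proof (induction k)
  case 0
  show ?case
    by (rule exI[of _ 0]) simp
next
  case (Suc k)
  let ?f = "cyc (Suc k) f" and ?v = "fold (tau_T t) [1..<Suc k] v"
  obtain r where r: "fold (bT t) [1..<Suc k] (tensor f v) = tensor ?f ?v + scale (X (Suc k)) r"
    using Suc by blast
  obtain r' where r': "bT t (Suc k) (scale (X (Suc k)) r) = scale (X (Suc (Suc k))) r'"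
    using bT_scale_X by blast
  have "fold (bT t) [1..<Suc (Suc k)] (tensor f v)
      = bT t (Suc k) (fold (bT t) [1..<Suc k] (tensor f v))"
    by simp
  also have "\<dots> = tensor (ddx t (Suc k) ?f) ?v
      + tensor (cyc (Suc (Suc k)) f) (tau_T t (Suc k) ?v) + scale (X (Suc (Suc k))) r'"
    unfolding r by (simp add: bT_add bT_tensor r' swap_vars_cyc)
  also have "ddx t (Suc k) ?f = X (Suc (Suc k)) * (Const (1 - t) * ddiff (Suc k) ?f)"
    by (simp add: ddx_def mult.left_commute)
  also have "tau_T t (Suc k) ?v = fold (tau_T t) [1..<Suc (Suc k)] v"
    by simp
  finally show ?case
    by (intro exI[of _ "tensor (Const (1 - t) * ddiff (Suc k) ?f) ?v + r'"])
      (simp add: tensor_mult_left scale.scale_right_distrib add_ac del: upt_Suc)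
qed

lemma fold_bT_zero [simp]: "fold (bT t) xs 0 = 0"
  by (induction xs) simp_all

lemma fold_bT_add: "fold (bT t) xs (p + r) = fold (bT t) xs p + fold (bT t) xs r"
  by (induction xs arbitrary: p r) (simp_all add: bT_add)

lemma Const_powi_cancel:
  assumes "t \<noteq> 0" "1 \<le> N"
  shows "Const (t ^ (N - 1)) * Const (t powi (1 - int N)) = 1"
proof -
  have "t ^ (N - 1) * t powi (1 - int N) = t powi (int (N - 1) + (1 - int N))"
    by (simp add: power_int_add assms(1))
  also have "int (N - 1) + (1 - int N) = 0"
    using assms(2) by simp
  finally show ?thesis
    by (simp flip: Const_mult)
qed

text \<open>On f \<otimes> S both terms agree modulo x_N with the tensor of \<open>cyc N f\<close>
  and S T_1 ... T_{N-1}. Taking h = p T_{N-1}^{-1} ... T_1^{-1} makes p - p E_N divisible by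
  x_N.\<close>

lemma fold_bT_mod_X:
  assumes "t \<noteq> 0" "1 \<le> N" and h: "\<And>S. lookup h S \<in> Pol N"
  shows "\<exists>r. fold (bT t) [1..<N] h - scale (Const (t ^ (N - 1))) (bw N q t h) = scale (X N) r"
proof (induction h rule: poly_mapping_additiveI)
  case 1
  show ?case
    by (rule exI[of _ 0]) simp
next
  case (2 p p')
  then obtain r r' where
    "fold (bT t) [1..<N] p - scale (Const (t ^ (N - 1))) (bw N q t p) = scale (X N) r"
    "fold (bT t) [1..<N] p' - scale (Const (t ^ (N - 1))) (bw N q t p') = scale (X N) r'"
    by blast
  then have "fold (bT t) [1..<N] (p + p') - scale (Const (t ^ (N - 1))) (bw N q t (p + p'))
      = scale (X N) (r + r')"
    by (simp add: fold_bT_add bw_add scale.scale_right_distrib algebra_simps)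
  then show ?case
    by blast
next
  case (3 S)
  let ?f = "lookup h S" and ?v = "fold (tau_T t) [1..<N] (single S 1)"
  obtain r where r: "fold (bT t) [1..<N] (single S ?f) = tensor (cyc N ?f) ?v + scale (X N) r"
    using fold_bT_tensor_mod_X[of t "N - 1" ?f "single S 1"] assms(2) by (auto simp: tensor_single)
  obtain s where s: "omega N q ?f = cyc N ?f + X N * s"
    using X_dvd_omega_diff_cyc[OF h[of S], of q] by (auto simp: dvd_def algebra_simps)
  have "scale (Const (t ^ (N - 1))) (bw N q t (single S ?f))
      = tensor ((Const (t ^ (N - 1)) * Const (t powi (1 - int N))) * omega N q ?f) ?v"
    by (simp only: bw_single mult.assoc flip: tensor_mult_left)
  also have "\<dots> = tensor (omega N q ?f) ?v"
    by (simp only: Const_powi_cancel[OF assms(1,2)] mult_1)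
  also have "\<dots> = tensor (cyc N ?f) ?v + scale (X N) (tensor s ?v)"
    by (simp only: s tensor_add_left tensor_mult_left)
  finally have bw: "scale (Const (t ^ (N - 1))) (bw N q t (single S ?f))
      = tensor (cyc N ?f) ?v + scale (X N) (tensor s ?v)" .
  have "fold (bT t) [1..<N] (single S ?f)
      - scale (Const (t ^ (N - 1))) (bw N q t (single S ?f)) = scale (X N) (r - tensor s ?v)"
    unfolding r bw scale.scale_right_diff_distrib by simp
  then show ?case
    by blast
qed

section \<open>The map \<open>\<rho>\<close>\<close>

text \<open>The restriction of \<rho> to constant coefficients: the linear map from V_\<tau> to the
  span of the g_S.\<close>

definition tab_eval :: "(tableau \<Rightarrow> 'f mpoly) \<Rightarrow> ('f::field) tabvec \<Rightarrow> 'f mpoly" where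
  "tab_eval g v = (\<Sum>S\<in>keys v. Const (lookup v S) * g S)"

lemma tab_eval_zero [simp]: "tab_eval g 0 = 0"
  by (simp add: tab_eval_def)

lemma tab_eval_add: "tab_eval g (v + w) = tab_eval g v + tab_eval g w"
  unfolding tab_eval_def by (rule sum_keys_add) (simp_all add: Const_add distrib_right)

lemma tab_eval_single: "tab_eval g (single S c) = Const c * g S"
  by (cases "c = 0") (simp_all add: tab_eval_def)

lemma tab_eval_scale: "tab_eval g (scale c v) = Const c * tab_eval g v"
  by (induction v rule: poly_mapping_add_induct[OF subset_UNIV])
    (simp_all add: tab_eval_single tab_eval_add scale.scale_right_distrib Const_mult distrib_left)

lemma tab_eval_uminus: "tab_eval g (- v) = - tab_eval g v"
  using tab_eval_add[of g v "- v"] by (simp add: eq_neg_iff_add_eq_0 add.commute)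

text \<open>Each rule is a linear combination of vectors of the family, hence is preserved by linear
  maps.\<close>

lemma tab_eval_young_rule:
  "tab_eval g (young_rule scale t i (\<lambda>S'. single S' 1) S) = young_rule scale t i g S"
  unfolding young_rule_def Let_def
  by (simp add: tab_eval_add tab_eval_scale tab_eval_single tab_eval_uminus scale_eq_Const_mult
      del: scale_single)

lemma rho_zero [simp]: "rho g 0 = 0"
  by (simp add: rho_def extend_def)

lemma rho_add: "rho g (p + r) = rho g p + rho g r"
  unfolding rho_def extend_def by (rule sum_keys_add) (simp_all add: distrib_right)

lemma rho_single: "rho g (single S f) = f * g S"
  unfolding rho_def extend_def by (cases "f = 0") simp_all

lemma rho_scale: "rho g (scale c p) = c * rho g p"
  by (induction p rule: poly_mapping_add_induct[OF subset_UNIV])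
    (simp_all add: rho_single rho_add scale.scale_right_distrib distrib_left mult.assoc)

lemma rho_diff: "rho g (p - r) = rho g p - rho g r"
  using rho_add[of g "p - r" r] by simp

lemma rho_tensor: "rho g (tensor f v) = f * tab_eval g v"
  by (induction v rule: poly_mapping_add_induct[OF subset_UNIV])
    (simp_all add: tensor_single rho_single tensor_add_right rho_add tab_eval_single tab_eval_add
      distrib_left)

lemma tab_eval_inj:
  assumes indep: "\<not> module.dependent scale (g ` B)" and inj: "inj_on g B"
    and v: "keys v \<subseteq> B" and eq: "tab_eval g v = 0"
  shows "v = 0"
proof -
  have inj': "inj_on g (keys v)"
    using inj v by (rule inj_on_subset)
  \<comment> \<open>\<open>u\<close> transports the coefficients of \<open>v\<close> to the vectors
    \<open>g S\<close>, on which linear independence is formulated.\<close>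
  define u where "u = (\<lambda>x. lookup v (inv_into (keys v) g x))"
  have "(\<Sum>x\<in>g ` keys v. scale (u x) x) = tab_eval g v"
    unfolding tab_eval_def
    by (simp add: sum.reindex inj' u_def scale_eq_Const_mult inv_into_f_f cong: sum.cong)
  then have "u x = 0" if "x \<in> g ` keys v" for x
    using scale.independentD[OF indep, of "g ` keys v" u x] v eq that by (auto intro: image_mono)
  then have "lookup v S = 0" if "S \<in> keys v" for S
    using that by (metis imageI inj' inv_into_f_f u_def)
  then show ?thesis
    by (intro poly_mapping_eqI) (auto simp: in_keys_iff)
qed

section \<open>Families with property (SMP)\<close>

locale singular_isotype =
  fixes N :: nat and q t :: "'f::field" and \<tau> :: "nat list" and g :: "tableau \<Rightarrow> 'f mpoly"
  assumes t_nonzero: "t \<noteq> 0" and N_pos: "1 \<le> N" and smp: "SMP N q t \<tau> g"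
begin

lemma g_Pol: "S \<in> Tab N \<tau> \<Longrightarrow> g S \<in> Pol N"
  using smp by (auto simp: SMP_def isotype_basis_def)

lemma T_g: "S \<in> Tab N \<tau> \<Longrightarrow> 1 \<le> i \<Longrightarrow> i < N \<Longrightarrow> T t i (g S) = young_rule scale t i g S"
  using smp by (auto simp: SMP_def isotype_basis_def)

lemma keys_tau_T:
  assumes i: "1 \<le> i" "i < N" and v: "keys v \<subseteq> Tab N \<tau>"
  shows "keys (tau_T t i v) \<subseteq> Tab N \<tau>"
  using v
proof (induction v rule: poly_mapping_add_induct)
  case (single S c)
  \<comment> \<open>\<open>swap_entries i S\<close> occurs only in branches where \<open>i\<close>
    and \<open>i + 1\<close> lie in different rows and different columns.\<close>
  have "keys (young_rule scale t i (\<lambda>S'. single S' 1) S) \<subseteq> Tab N \<tau>"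
    using single swap_entries_Tab[OF single i]
    unfolding young_rule_def Let_def
    by (simp add: keys_uminus keys_add_subset)
  then show ?case
    unfolding tau_T_single by (rule keys_scale_subset)
next
  case (add v w)
  then show ?case
    unfolding tau_T_add by (intro keys_add_subset)
qed simp

lemma keys_fold_tau_T:
  "set xs \<subseteq> {1..<N} \<Longrightarrow> keys v \<subseteq> Tab N \<tau> \<Longrightarrow> keys (fold (tau_T t) xs v) \<subseteq> Tab N \<tau>"
  by (induction xs arbitrary: v) (simp_all add: keys_tau_T)

lemma tab_eval_tau_T:
  assumes i: "1 \<le> i" "i < N" and "keys v \<subseteq> Tab N \<tau>"
  shows "tab_eval g (tau_T t i v) = T t i (tab_eval g v)"
  using assms(3)
  by (induction v rule: poly_mapping_add_induct)
    (simp_all add: tau_T_single tab_eval_scale tab_eval_young_rule tab_eval_single T_g[OF _ i]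
      T_Const_mult tau_T_add tab_eval_add T_add)

text \<open>Since \<open>g\<close> is linearly independent, the quadratic relation on \<open>V\<^sub>\<tau>\<close> is inherited from the
  polynomials, and no computation with the rules (I)--(IV) is needed.\<close>

lemma tau_T_quadratic:
  assumes i: "1 \<le> i" "i < N" and v: "keys v \<subseteq> Tab N \<tau>"
  shows "tau_T t i (tau_T t i v) = scale (t - 1) (tau_T t i v) + scale t v"
proof -
  let ?w = "tau_T t i v"
  let ?d = "tau_T t i ?w + - (scale (t - 1) ?w + scale t v)"
  note w = keys_tau_T[OF i v]
  have "keys ?d \<subseteq> Tab N \<tau>"
    by (intro keys_add_subset keys_tau_T[OF i w] equalityD1[OF keys_uminus, THEN subset_trans]
        keys_scale_subset v w)
  moreover have "tab_eval g ?d = 0"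
    by (simp only: tab_eval_add tab_eval_uminus tab_eval_scale tab_eval_tau_T[OF i v]
        tab_eval_tau_T[OF i w] T_quadratic) simp
  ultimately have "?d = 0"
    using smp unfolding SMP_def isotype_basis_def by (blast intro: tab_eval_inj)
  then show ?thesis
    by (simp only: add_eq_0_iff2 minus_minus)
qed

section \<open>Invertibility of the vector-valued T_i\<close>

lemma VPol_induct [consumes 1, case_names zero single add]:
  assumes "p \<in> VPol N \<tau>" and "P 0"
    and "\<And>S f. S \<in> Tab N \<tau> \<Longrightarrow> f \<in> Pol N \<Longrightarrow> P (single S f)"
    and "\<And>p r. P p \<Longrightarrow> P r \<Longrightarrow> P (p + r)"
  shows "P p"
  by (rule poly_mapping_additiveI) (use assms in \<open>auto simp: VPol_def\<close>)

lemma bT_VPol: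
  assumes i: "1 \<le> i" "i < N" and "p \<in> VPol N \<tau>"
  shows "bT t i p \<in> VPol N \<tau>"
  using assms(3)
proof (induction p rule: VPol_induct)
  case (single S f)
  then have "ddx t i f \<in> Pol N" "swap_vars i f \<in> Pol N"
    using i by (auto simp: Pol_eq_Vars intro!: ddx_Vars swap_vars_Vars)
  with single show ?case
    unfolding bT_single by (intro VPol_add VPol_tensor keys_tau_T i) auto
qed (simp_all add: bT_add VPol_add)

text \<open>Stated without \<open>VPol\<close>: in the recursion for D_i only the tableaux occurring
  in intermediate values are tracked, not their coefficients.\<close>

lemma keys_bT:
  assumes i: "1 \<le> i" "i < N" and "keys p \<subseteq> Tab N \<tau>"
  shows "keys (bT t i p) \<subseteq> Tab N \<tau>"
  using assms(3)
proof (induction p rule: poly_mapping_add_induct)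
  case (single S f)
  then have "keys (tau_T t i (single S 1)) \<subseteq> Tab N \<tau>"
    by (intro keys_tau_T i) simp
  moreover have "keys (tensor (ddx t i f) (single S 1)) \<subseteq> Tab N \<tau>"
    using single keys_tensor[of "ddx t i f" "single S 1"] by auto
  ultimately show ?case
    unfolding bT_single by (intro keys_add_subset) (auto dest: subsetD[OF keys_tensor])
next
  case (add p r)
  then show ?case
    unfolding bT_add by (intro keys_add_subset)
qed simp

lemma bT_quadratic:
  assumes i: "1 \<le> i" "i < N" and "p \<in> VPol N \<tau>"
  shows "bT t i (bT t i p) = scale (Const (t - 1)) (bT t i p) + scale (Const t) p"
  using assms(3)
proof (induction p rule: VPol_induct)
  case (single S f)
  define v :: "'f tabvec" where "v = single S 1"
  let ?w = "tau_T t i v"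
  have "keys v \<subseteq> Tab N \<tau>"
    using single by (simp add: v_def)
  have "bT t i (bT t i (tensor f v)) = tensor (ddx t i (ddx t i f)) v
      + tensor (swap_vars i (ddx t i f) + ddx t i (swap_vars i f)) ?w
      + tensor f (tau_T t i ?w)"
    by (simp add: bT_tensor bT_add tensor_add_left)
  \<comment> \<open>The cross term leaves -(t - 1) f \<otimes> v T_i, which cancels against (t - 1)
    f \<otimes> v T_i from the quadratic relation of \<open>tau_T\<close>.\<close>
  also have "\<dots> = tensor (Const (t - 1) * ddx t i f) v
      + tensor (Const (t - 1) * swap_vars i f) ?w + tensor (Const t * f) v"
    unfolding ddx_ddx ddx_swap_vars tau_T_quadratic[OF i \<open>keys v \<subseteq> Tab N \<tau>\<close>]
    by (rule poly_mapping_eqI,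
        simp only: lookup_add lookup_tensor lookup_scale Const_add Const_mult,
        simp only: algebra_simps add_diff_eq diff_add_cancel)
  also have "\<dots> = scale (Const (t - 1)) (bT t i (tensor f v)) + scale (Const t) (tensor f v)"
    by (simp add: bT_tensor tensor_mult_left scale.scale_right_distrib)
  finally show ?case
    by (simp add: v_def tensor_single)
qed (simp_all add: bT_add scale.scale_right_distrib)

text \<open>The quadratic relation provides the inverse (T_i - (t - 1)) / t, which preserves
  \<open>VPol\<close>. This makes \<open>bT_inv\<close> a genuine inverse there.\<close>

lemma bT_bij:
  assumes i: "1 \<le> i" "i < N"
  shows "bij_betw (bT t i) (VPol N \<tau>) (VPol N \<tau>)"
proof -
  define U where "U p = scale (Const (1 / t)) (bT t i p - scale (Const (t - 1)) p)" for p
  have inverse: "Const (1 / t) * Const t = 1"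
    using t_nonzero by (simp flip: Const_mult)
  have UT: "U (bT t i p) = p" if "p \<in> VPol N \<tau>" for p
    unfolding U_def bT_quadratic[OF i that] by (simp add: inverse)
  have "bT t i (U p) = U (bT t i p)" for p
    using bT_add[of t i "bT t i p - scale (Const (t - 1)) p" "scale (Const (t - 1)) p"]
    by (simp add: U_def bT_scale)
  then have TU: "bT t i (U p) = p" if "p \<in> VPol N \<tau>" for p
    using UT[OF that] by simp
  have "U p \<in> VPol N \<tau>" if "p \<in> VPol N \<tau>" for p
    unfolding U_def using that
    by (intro VPol_scale VPol_diff bT_VPol i) (auto simp: Pol_eq_Vars)
  then show ?thesis
    using UT TU bT_VPol[OF i] by (intro bij_betw_byWitness[of _ U]) auto
qed

lemma
  assumes i: "1 \<le> i" "i < N" and p: "p \<in> VPol N \<tau>"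
  shows bT_inv_VPol: "bT_inv N \<tau> t i p \<in> VPol N \<tau>"
    and bT_bT_inv: "bT t i (bT_inv N \<tau> t i p) = p"
  using bT_bij[OF i] p unfolding bT_inv_def
  by (auto simp: bij_betw_def inv_into_into f_inv_into_f)

section \<open>Intertwining of T_i and its inverse\<close>

lemma rho_Pol: "p \<in> VPol N \<tau> \<Longrightarrow> rho g p \<in> Pol N"
  by (induction p rule: VPol_induct)
    (simp_all add: rho_single rho_add g_Pol Pol_zero Pol_add Pol_mult)

lemma rho_bT:
  assumes i: "1 \<le> i" "i < N" and p: "keys p \<subseteq> Tab N \<tau>"
  shows "rho g (bT t i p) = T t i (rho g p)"
  using p
proof (induction p rule: poly_mapping_add_induct)
  case (single S f)
  then have "tab_eval g (tau_T t i (single S 1)) = T t i (g S)"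
    by (simp add: tab_eval_tau_T[OF i] tab_eval_single)
  then show ?case
    by (simp add: bT_single rho_add rho_tensor tab_eval_single rho_single T_mult)
qed (simp_all add: bT_add rho_add T_add)

lemma VPol_keys: "p \<in> VPol N \<tau> \<Longrightarrow> keys p \<subseteq> Tab N \<tau>"
  by (simp add: VPol_def)

lemma rho_bT_inv:
  assumes i: "1 \<le> i" "i < N" and p: "p \<in> VPol N \<tau>"
  shows "rho g (bT_inv N \<tau> t i p) = T_inv N t i (rho g p)"
proof -
  have "rho g p = T t i (rho g (bT_inv N \<tau> t i p))"
    using rho_bT[OF i VPol_keys[OF bT_inv_VPol[OF i p]]] by (simp add: bT_bT_inv[OF i p])
  moreover have "T_inv N t i (rho g p) = T_linv t i (rho g p)"
    using i p by (simp add: T_inv_eq_T_linv t_nonzero rho_Pol)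
  ultimately show ?thesis
    by (simp add: T_linv_T t_nonzero)
qed

section \<open>The action of \<omega> on the g_S\<close>

lemma xi_last_g:
  assumes "S \<in> Tab N \<tau>"
  shows "xi N q t N (g S) = g S"
proof -
  have "D N q t N (g S) = 0"
    using smp assms N_pos by (simp add: SMP_def singular_def)
  then have "exact_quot (g S - xi N q t N (g S)) (X N) = 0"
    by (simp add: D.simps)
  \<comment> \<open>A zero value of \<open>exact_quot\<close> is informative only when the division
    is exact; here it forces r = 0.\<close>
  moreover obtain r where "g S - xi N q t N (g S) = r * X N"
    using X_dvd_diff_xi[OF t_nonzero N_pos g_Pol[OF assms]] by (metis dvdE mult.commute)
  ultimately show ?thesis
    by (simp add: exact_quot_mult X_neq_zero)
qed

text \<open>Extends \<open>xi_last_g\<close> from the g_S to their span by linearity, which is why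
  it is phrased with \<open>T_linv\<close>.\<close>

lemma fold_T_linv_omega:
  assumes "keys v \<subseteq> Tab N \<tau>"
  shows "Const (t ^ (N - 1)) * omega N q (fold (T_linv t) (rev [1..<N]) (tab_eval g v)) = tab_eval g v"
proof -
  have fold_zero: "fold (T_linv t) xs 0 = 0"
    and fold_add: "fold (T_linv t) xs (p + r) = fold (T_linv t) xs p + fold (T_linv t) xs r"
    and fold_mult: "fold (T_linv t) xs (Const c * p) = Const c * fold (T_linv t) xs p" for xs p r c
    by (induction xs arbitrary: p r) (simp_all add: T_linv_add T_linv_Const_mult)
  show ?thesis
    using assms
  proof (induction v rule: poly_mapping_add_induct)
    case (single S c)
    then show ?case
      using xi_last_g[OF single] unfolding xi_last_eq[OF t_nonzero g_Pol[OF single]]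
      by (simp only: tab_eval_single fold_mult omega_mult omega_Const mult.left_commute)
  next
    case (add v w)
    then show ?case
      by (simp only: tab_eval_add fold_add omega_add distrib_left)
  qed (simp add: fold_zero)
qed

lemma omega_g:
  assumes "S \<in> Tab N \<tau>"
  shows "omega N q (g S) = Const (t powi (1 - int N)) * tab_eval g (fold (tau_T t) [1..<N] (single S 1))"
proof -
  let ?v = "fold (tau_T t) [1..<N] (single S 1)"
  have v: "keys (single S (1::'f)) \<subseteq> Tab N \<tau>"
    using assms by simp
  have "tab_eval g ?v = fold (T t) [1..<N] (tab_eval g (single S 1))"
    by (rule fold_intertwine[of _ "{v. keys v \<subseteq> Tab N \<tau>}"])
      (use v in \<open>simp_all add: tab_eval_tau_T keys_tau_T\<close>)
  \<comment> \<open>\<open>?v\<close> is S T_1 ... T_{N-1}, so the inverses inside \<xi>_N undo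
    exactly these operators and leave g_S.\<close>
  then have "fold (T_linv t) (rev [1..<N]) (tab_eval g ?v)
      = fold (T_linv t) (rev [1..<N]) (fold (T t) [1..<N] (g S))"
    by (simp add: tab_eval_single)
  also have "\<dots> = g S"
    by (rule fold_inverse[of _ UNIV]) (simp_all add: T_linv_T t_nonzero)
  finally have "Const (t ^ (N - 1)) * omega N q (g S) = tab_eval g ?v"
    using fold_T_linv_omega[OF keys_fold_tau_T[OF _ v], of "[1..<N]"] by simp
  then have "Const (t powi (1 - int N)) * tab_eval g ?v
      = (Const (t ^ (N - 1)) * Const (t powi (1 - int N))) * omega N q (g S)"
    by (simp add: mult_ac)
  then show ?thesis
    by (simp only: Const_powi_cancel[OF t_nonzero N_pos] mult_1)
qed

section \<open>Intertwining of w, E_i and D_i\<close>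

lemma rho_bw:
  assumes "p \<in> VPol N \<tau>"
  shows "rho g (bw N q t p) = omega N q (rho g p)"
  using assms
  by (induction p rule: VPol_induct)
    (simp_all add: bw_single rho_tensor rho_single omega_mult omega_g bw_add rho_add omega_add
      mult_ac)

lemma bw_VPol:
  assumes "p \<in> VPol N \<tau>"
  shows "bw N q t p \<in> VPol N \<tau>"
  using assms
proof (induction p rule: VPol_induct)
  case (single S f)
  then show ?case
    unfolding bw_single using omega_Pol[OF N_pos, of f q]
    by (intro VPol_tensor keys_fold_tau_T) (auto simp: Pol_eq_Vars intro: Vars_mult)
qed (simp_all add: bw_add VPol_add)

lemma fold_bT_inv_VPol:
  "set xs \<subseteq> {1..<N} \<Longrightarrow> p \<in> VPol N \<tau> \<Longrightarrow> fold (bT_inv N \<tau> t) xs p \<in> VPol N \<tau>"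
  by (rule fold_closed) (auto intro!: bT_inv_VPol)

lemma rho_bE:
  assumes i: "i \<in> {1..N}" and p: "p \<in> VPol N \<tau>"
  shows "rho g (bE N \<tau> q t i p) = xi N q t i (rho g p)"
proof -
  let ?h = "fold (bT_inv N \<tau> t) (rev [1..<i]) p"
  have h: "?h \<in> VPol N \<tau>"
    using i p by (intro fold_bT_inv_VPol) auto
  have "rho g ?h = fold (T_inv N t) (rev [1..<i]) (rho g p)"
    by (rule fold_intertwine[of _ "VPol N \<tau>"]) (use i p in \<open>auto intro!: bT_inv_VPol rho_bT_inv\<close>)
  moreover have "rho g (fold (bT t) (rev [i..<N]) (bw N q t ?h))
      = fold (T t) (rev [i..<N]) (rho g (bw N q t ?h))"
    by (rule fold_intertwine[of _ "VPol N \<tau>"])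
      (use i bw_VPol[OF h] in \<open>auto intro!: bT_VPol rho_bT VPol_keys\<close>)
  ultimately show ?thesis
    by (simp only: bE_def xi_def rho_scale rho_bw[OF h] scale_eq_Const_mult)
qed

lemma diff_bE_last:
  assumes p: "p \<in> VPol N \<tau>"
  obtains r where "p - bE N \<tau> q t N p = scale (X N) r"
proof -
  let ?h = "fold (bT_inv N \<tau> t) (rev [1..<N]) p"
  have h: "?h \<in> VPol N \<tau>"
    using p by (intro fold_bT_inv_VPol) auto
  have "fold (bT t) (rev (rev [1..<N])) ?h = p"
    by (rule fold_inverse[of _ "VPol N \<tau>"]) (use p in \<open>auto intro!: bT_inv_VPol bT_bT_inv\<close>)
  moreover obtain r where
    "fold (bT t) [1..<N] ?h - scale (Const (t ^ (N - 1))) (bw N q t ?h) = scale (X N) r"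
    using fold_bT_mod_X[of t N ?h q] t_nonzero N_pos h by (auto simp: VPol_def)
  ultimately have "p - bE N \<tau> q t N p = scale (X N) r"
    by (simp add: bE_def)
  then show thesis
    by (rule that)
qed

lemma bE_last_VPol:
  assumes p: "p \<in> VPol N \<tau>"
  shows "bE N \<tau> q t N p \<in> VPol N \<tau>"
proof -
  have "fold (bT_inv N \<tau> t) (rev [1..<N]) p \<in> VPol N \<tau>"
    using p by (intro fold_bT_inv_VPol) auto
  then show ?thesis
    by (simp add: bE_def VPol_scale bw_VPol Pol_eq_Vars)
qed

text \<open>Induction on \<open>N - i\<close> follows the recursion from D_{i+1} to D_i, with
  \<open>p\<close> varying because T_i is applied first. The keys are carried along so that
  \<open>rho_bT\<close> applies to the output of D_{i+1}.\<close>

lemma keys_rho_bD: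
  assumes "i \<in> {1..N}" and "p \<in> VPol N \<tau>"
  shows "keys (bD N \<tau> q t i p) \<subseteq> Tab N \<tau> \<and> rho g (bD N \<tau> q t i p) = D N q t i (rho g p)"
  using assms
proof (induction "N - i" arbitrary: i p)
  case 0
  then have i: "i = N" and p: "p \<in> VPol N \<tau>"
    by simp_all
  obtain r where r: "p - bE N \<tau> q t N p = scale (X N) r"
    using diff_bE_last p by blast
  have D: "bD N \<tau> q t N p = r"
    by (simp add: bD.simps r map_exact_quot_scale X_neq_zero)
  have "keys (p - bE N \<tau> q t N p) \<subseteq> Tab N \<tau>"
    by (intro VPol_keys VPol_diff bE_last_VPol p)
  \<comment> \<open>Multiplication by x_N kills no coefficient, so \<open>r\<close> and x_N r have
    the same support.\<close>
  then have "keys r \<subseteq> Tab N \<tau>"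
    unfolding r by (auto simp: in_keys_iff lookup_scale X_neq_zero)
  \<comment> \<open>\<rho> is linear over polynomials, so the scalar division is exact as well, with
    quotient \<open>rho g r\<close>.\<close>
  moreover have "rho g p - xi N q t N (rho g p) = rho g (scale (X N) r)"
    using N_pos p rho_bE[of N p] by (simp add: rho_diff flip: r)
  then have "D N q t N (rho g p) = rho g r"
    by (simp add: D.simps rho_scale mult.commute[of "X N"] exact_quot_mult X_neq_zero)
  ultimately show ?case
    using D i by simp
next
  case (Suc k)
  then have i: "1 \<le> i" "i < N"
    by auto
  let ?p = "bD N \<tau> q t (i + 1) (bT t i p)"
  have IH: "keys ?p \<subseteq> Tab N \<tau> \<and> rho g ?p = D N q t (i + 1) (rho g (bT t i p))"
    using Suc.hyps(2) Suc.prems i by (intro Suc.hyps(1) bT_VPol) auto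
  have D: "bD N \<tau> q t i p = scale (Const (1 / t)) (bT t i ?p)"
    using i by (simp add: bD.simps[of _ _ _ _ i])
  have "keys (bD N \<tau> q t i p) \<subseteq> Tab N \<tau>"
    unfolding D by (intro keys_scale_subset keys_bT i conjunct1[OF IH])
  moreover have "rho g (bD N \<tau> q t i p) = Const (1 / t) * T t i (rho g ?p)"
    unfolding D rho_scale rho_bT[OF i conjunct1[OF IH]] ..
  moreover have "rho g ?p = D N q t (i + 1) (T t i (rho g p))"
    using IH rho_bT[OF i VPol_keys[OF Suc.prems(2)]] by simp
  moreover have "D N q t i (rho g p) = Const (1 / t) * T t i (D N q t (i + 1) (T t i (rho g p)))"
    using i by (simp add: D.simps[of _ _ _ i] scale_eq_Const_mult)
  ultimately show ?case
    by simp
qed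

end

theorem theorem3p8:
  fixes emb :: "complex \<Rightarrow> 'f::field" and t q :: 'f
    and N :: nat and \<tau> :: "nat list" and g :: "tableau \<Rightarrow> 'f mpoly"
  assumes "field_embedding emb" and "transcendental_over emb t" and "q \<noteq> 0"
    and "N \<ge> 2" and "partition_of N \<tau>"
    and "SMP N q t \<tau> g"
  shows "(\<forall>p\<in>VPol N \<tau>. rho g (bw N q t p) = omega N q (rho g p)) \<and>
         (\<forall>i\<in>{1..N}. \<forall>p\<in>VPol N \<tau>. rho g (bE N \<tau> q t i p) = xi N q t i (rho g p)) \<and>
         (\<forall>i\<in>{1..N}. \<forall>p\<in>VPol N \<tau>. rho g (bD N \<tau> q t i p) = D N q t i (rho g p))"
proof -
  \<comment> \<open>Transcendence is applied to the polynomial \<open>[:0, 1:]\<close>, whose value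
    at \<open>t\<close> is \<open>t\<close>, to get \<open>t \<noteq> 0\<close>.\<close>
  have "map_poly emb [:0, 1:] = [:0, 1:]"
    using assms(1) by (simp add: field_embedding_def map_poly_pCons)
  then have "poly [:0, 1:] t \<noteq> 0"
    using assms(2) unfolding transcendental_over_def by (metis pCons_eq_0_iff one_neq_zero)
  then interpret singular_isotype N q t \<tau> g
    using assms(4,6) by unfold_locales auto
  show ?thesis
    using rho_bw rho_bE keys_rho_bD by blast
qed

end
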